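(* Let $(\Omega,\mathcal F,\mathbb P)$ be a probability space with a filtration $\{\mathcal F_k:k\in\mathbb N\}$, and write $\mathbb E_k[\cdot]:=\mathbb E[\cdot\mid\mathcal F_k]$. Let $\Psi:\mathbb R^d\to(-\infty,+\infty]$ be proper and lower semicontinuous. Let $\{X^k:k\in\mathbb N\}\subset\operatorname{dom}\Psi$ be adapted, and assume there is a deterministic constant $\underline\Psi\in\mathbb R$ such that $\Psi(X^k)\ge\underline\Psi$ almost surely for every $k\in\mathbb N$. Let $\{\lambda_{\ell,k}:k\in\mathbb N\}$, $\ell=1,\dots,m$, be nonnegative adapted sequences (with $\lambda_{\ell,k}:=0$ for $k<0$). Let $\{\sigma_k:k\in\mathbb N\}$ be nonnegative and deterministic, set $$S_k:=\sum_{j=k+1}^\infty\sigma_j,\qquad D_k:=\sum_{\ell=1}^m(\lambda_{\ell,k+1}+\lambda_{\ell,k}+\lambda_{\ell,k-1}),$$ and assume $\sum_{k=0}^\infty S_k^q<+\infty$ for some $q\in(0,1)$. Suppose that the quantities involved in the conditional expectations below are integrable and that, for all $k\ge k_0$, where $k_0$ is deterministic, the following hold. (i) (Conditional expected descent) There exist constants $a_{1,\ell}>0$ and $a_{2,\ell},a_{3,\ell}\in\mathbb R$, $\ell=1,\dots,m$, such that $a_{2,\ell}+\max\{a_{3,\ell},0\}<a_{1,\ell}$ and $$\mathbb E_k[\Psi(X^{k+1})]\le\Psi(X^k)-\sum_{\ell=1}^m a_{1,\ell}\mathbb E_k[\lambda_{\ell,k+1}^2]+\sum_{\ell=1}^m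 a_{2,\ell}\lambda_{\ell,k}^2+\sum_{\ell=1}^m a_{3,\ell}\lambda_{\ell,k-1}^2+\sigma_{k+1}.$$ (ii) (Relative error) There exists $C_{\rm re}>0$ such that $\operatorname{dist}(0,\partial\Psi(X^k))\le C_{\rm re}(D_k+S_k^q)$ for all sufficiently large $k$. (iii) (Continuity) $\Psi$ is continuous relative to $\operatorname{dom}\Psi$. Then the following statements hold. (I) The sequence $\{\Psi(X^k)\}$ converges almost surely to a finite random variable $\Psi_\infty$. Moreover, $S_k\to0$ and $\lambda_{\ell,k}\to0$ almost surely for $\ell=1,\dots,m$. In addition, every cluster point of $\{X^k\}$ is almost surely stationary, that is, it belongs to $\operatorname{crit}\Psi:=\{x\in\mathbb R^d:0\in\partial\Psi(x)\}$. (II) Assume further: (iv) there exists a deterministic constant $\Psi_*$ such that $\Psi_\infty=\Psi_*$ almost surely; (v) there exists a deterministic compact set $S_\Psi\subset\mathbb R^d$ such that $\{X^k:k\in\mathbb N\}\subseteq S_\Psi$ almost surely; (vi) the set $\Omega_*:=\{x\in S_\Psi:\Psi(x)=\Psi_*,\ 0\in\partial\Psi(x)\}$ is nonempty and compact, and $\Psi$ satisfies the KL property at every point of $\Omega_*$. Then $\sum_{k=0}^\infty D_k<+\infty$ almost surely. If, in addition, there exists $C_S>0$ such that $$\|X^{k+1}-X^k\|\le C_S(D_{k+1}+S_k^q)$$ for all sufficiently large $k$, then $\sum_{k=0}^\infty\|X^{k+1}-X^k\|<+\infty$ almost surely, and consequently $\{X^k\}$ converges almost surely to some $X^*\in\o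peratorname{crit}\Psi$.
   Context: $\mathbb N=\{0,1,2,\dots\}$. $\partial\Psi$ denotes the limiting (Mordukhovich) subdifferential, $\operatorname{dom}\Psi=\{x:\Psi(x)<+\infty\}$, $\operatorname{dom}\partial\Psi=\{x\in\operatorname{dom}\Psi:\partial\Psi(x)\ne\emptyset\}$, and $\operatorname{dist}(0,S)=\inf_{y\in S}\|y\|$. KL property. A proper lower semicontinuous $\phi:\mathbb R^d\to(-\infty,+\infty]$ satisfies the KL property at $\bar x\in\operatorname{dom}\partial\phi$ if there exist $\varepsilon>0$, $\delta>0$ and a continuous concave $\varphi:[0,\varepsilon)\to[0,+\infty)$ with $\varphi(0)=0$, $\varphi$ continuously differentiable on $(0,\varepsilon)$ and $\varphi'>0$ there, such that $\varphi'(\phi(x)-\phi(\bar x))\operatorname{dist}(0,\partial\phi(x))\ge1$ for all $x$ with $\|x-\bar x\|<\delta$ and $\phi(\bar x)<\phi(x)<\phi(\bar x)+\varepsilon$. *)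

theory Defs
  imports "HOL-Probability.Probability" "HOL-Probability.Stopping_Time"
begin

definition edom :: "('a \<Rightarrow> ereal) \<Rightarrow> 'a set" where
  "edom f = {x. f x < \<infinity>}"

definition proper_fun :: "('a \<Rightarrow> ereal) \<Rightarrow> bool" where
  "proper_fun f \<longleftrightarrow> (\<forall>x. f x \<noteq> - \<infinity>) \<and> edom f \<noteq> {}"

definition lower_semicont :: "('a::topological_space \<Rightarrow> ereal) \<Rightarrow> bool" where
  "lower_semicont f \<longleftrightarrow> (\<forall>x. f x \<le> Liminf (at x) f)"

definition regular_subdiff :: "('a::real_inner \<Rightarrow> ereal) \<Rightarrow> 'a \<Rightarrow> 'a set" where
  "regular_subdiff f x = {v. \<bar>f x\<bar> \<noteq> \<infinity> \<and>
     0 \<le> Liminf (at x) (\<lambda>y. (f y - f x - ereal (v \<bullet> (y - x))) / ereal (norm (y - x)))}"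

text \<open>The limiting (Mordukhovich) subdifferential; it is empty outside the effective domain.\<close>

definition limiting_subdiff :: "('a::real_inner \<Rightarrow> ereal) \<Rightarrow> 'a \<Rightarrow> 'a set" where
  "limiting_subdiff f x = {v. \<bar>f x\<bar> \<noteq> \<infinity> \<and>
     (\<exists>y w. y \<longlonglongrightarrow> x \<and> (\<lambda>n. f (y n)) \<longlonglongrightarrow> f x \<and>
            (\<forall>n. w n \<in> regular_subdiff f (y n)) \<and> w \<longlonglongrightarrow> v)}"

definition dom_subdiff :: "('a::real_inner \<Rightarrow> ereal) \<Rightarrow> 'a set" where
  "dom_subdiff f = {x \<in> edom f. limiting_subdiff f x \<noteq> {}}"

definition crit :: "('a::real_inner \<Rightarrow> ereal) \<Rightarrow> 'a set" where
  "crit f = {x. 0 \<in> limiting_subdiff f x}"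

text \<open>The distance of the origin to a set, with value \<open>\<infinity>\<close> for the empty set
  (unlike \<open>infdist\<close>, which is \<open>0\<close> there).\<close>

definition dist_zero :: "'a::real_normed_vector set \<Rightarrow> ereal" where
  "dist_zero S = (INF v\<in>S. ereal (norm v))"

definition KL_at :: "('a::real_inner \<Rightarrow> ereal) \<Rightarrow> 'a \<Rightarrow> bool" where
  "KL_at f z \<longleftrightarrow> z \<in> dom_subdiff f \<and>
     (\<exists>\<epsilon>>0. \<exists>\<delta>>0. \<exists>\<phi> \<phi>' :: real \<Rightarrow> real.
        continuous_on {0..<\<epsilon>} \<phi> \<and> concave_on {0..<\<epsilon>} \<phi> \<and>
        (\<forall>t\<in>{0..<\<epsilon>}. 0 \<le> \<phi> t) \<and> \<phi> 0 = 0 \<and>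
        (\<forall>t\<in>{0<..<\<epsilon>}. (\<phi> has_real_derivative \<phi>' t) (at t)) \<and>
        continuous_on {0<..<\<epsilon>} \<phi>' \<and> (\<forall>t\<in>{0<..<\<epsilon>}. 0 < \<phi>' t) \<and>
        (\<forall>x. norm (x - z) < \<delta> \<and> f z < f x \<and> f x < f z + ereal \<epsilon> \<longrightarrow>
             1 \<le> ereal (\<phi>' (real_of_ereal (f x - f z))) * dist_zero (limiting_subdiff f x)))"

text \<open>\<open>lag s k\<close> is the term of index \<open>k - 1\<close> of \<open>s\<close>, sequences being extended by zero to
  negative indices.\<close>

definition lag :: "(nat \<Rightarrow> 'w \<Rightarrow> real) \<Rightarrow> nat \<Rightarrow> 'w \<Rightarrow> real" where
  "lag s k \<omega> = (case k of 0 \<Rightarrow> 0 | Suc j \<Rightarrow> s j \<omega>)"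

text \<open>\<open>tail_sum \<sigma> k\<close> is the sum of \<open>\<sigma> j\<close> over \<open>j \<ge> k + 1\<close>; meaningful for summable \<open>\<sigma>\<close> only.\<close>

definition tail_sum :: "(nat \<Rightarrow> real) \<Rightarrow> nat \<Rightarrow> real" where
  "tail_sum \<sigma> k = (\<Sum>j. \<sigma> (j + Suc k))"

definition step_sum :: "nat \<Rightarrow> (nat \<Rightarrow> nat \<Rightarrow> 'w \<Rightarrow> real) \<Rightarrow> nat \<Rightarrow> 'w \<Rightarrow> real" where
  "step_sum m lam k \<omega> = (\<Sum>l=1..m. lam l (Suc k) \<omega> + lam l k \<omega> + lag (lam l) k \<omega>)"

end

theory Submission
  imports Defs
begin

text \<open>The Lyapunov function \<open>Y\<^sub>k = \<Psi>(X\<^sub>k) + \<Sum>\<^sub>l (b\<^sub>1 \<lambda>\<^sub>k\<^sup>2 + b\<^sub>2 \<lambda>\<^sub>k\<^sub>-\<^sub>1\<^sup>2) + S\<^sub>k\<close> is a supermartingale, bounded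
  below, whose expected decrease dominates \<open>D\<^sub>k\<^sup>2\<close>; it converges by Doob's upcrossing argument.
  If its limit is a constant, Fatou's lemma shows that \<open>Y\<^sub>k\<close> never drops below that constant, so
  \<open>e\<^sub>k = Y\<^sub>k - lim Y\<close> is again a nonnegative supermartingale. For a bounded concave \<open>\<phi>\<close> the tangent
  inequality makes \<open>\<phi>(e\<^sub>k)\<close> a supermartingale with decrease \<open>\<phi>'(e\<^sub>k) D\<^sub>k\<^sup>2\<close>, hence
  \<open>\<Sum> \<phi>'(e\<^sub>k) D\<^sub>k\<^sup>2 < \<infinity>\<close> almost surely. Taking for \<open>\<phi>\<close> finitely many KL functions and the powers
  \<open>t\<^sup>1\<^sup>/\<^sup>2\<close> and \<open>t\<^sup>1\<^sup>-\<^sup>q\<close>, the KL inequality and the relative error bound give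
  \<open>1 \<le> C \<phi>'(e\<^sub>k) (D\<^sub>k + S\<^sub>k\<^sup>q)\<close> for one of them, whence \<open>D\<^sub>k \<le> S\<^sub>k\<^sup>q + 2 C \<phi>'(e\<^sub>k) D\<^sub>k\<^sup>2\<close>, which is
  summable. This last step is pathwise, so the thresholds in the hypotheses may depend on the
  path.\<close>

section \<open>Limiting subdifferentials and the KL property\<close>

lemma lower_semicont_open_superlevel:
  assumes "lower_semicont f"
  shows "open {x. c < f x}"
proof (subst open_subopen, safe)
  fix x assume x: "c < f x"
  have "f x \<le> Liminf (at x) f" using assms by (simp add: lower_semicont_def)
  then have "eventually (\<lambda>y. c < f y) (at x)"
    using x by (simp add: le_Liminf_iff)
  \<comment> \<open>The filter \<open>at x\<close> omits the point itself, where the inequality is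
    the assumption \<open>x\<close>.\<close>
  then have "eventually (\<lambda>y. c < f y) (nhds x)"
    using x by (auto simp: eventually_at_filter elim: eventually_mono)
  then show "\<exists>T. open T \<and> x \<in> T \<and> T \<subseteq> {x. c < f x}"
    by (auto simp: eventually_nhds)
qed

lemma lower_semicont_borel_measurable:
  fixes f :: "'a::topological_space \<Rightarrow> ereal"
  assumes "lower_semicont f"
  shows "f \<in> borel_measurable borel"
  unfolding borel_measurable_ereal_iff_Ioi
proof
  fix c
  have "f -` {c<..} = {x. c < f x}" by auto
  then show "f -` {c<..} \<inter> space borel \<in> sets borel"
    using lower_semicont_open_superlevel[OF assms, of c] by simp
qed

lemma lower_semicont_le_limit:
  assumes "lower_semicont f" "x \<longlonglongrightarrow> a" "(\<lambda>n. f (x n)) \<longlonglongrightarrow> L"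
  shows "f a \<le> L"
proof (rule ccontr)
  assume "\<not> f a \<le> L"
  then obtain c where c: "L < c" "c < f a" by (meson dense not_le)
  have "\<forall>\<^sub>F n in sequentially. x n \<in> {x. c < f x}"
    using c(2) by (intro topological_tendstoD[OF assms(2)] lower_semicont_open_superlevel[OF assms(1)]) simp
  moreover have "\<forall>\<^sub>F n in sequentially. f (x n) < c"
    using assms(3) c(1) by (rule order_tendstoD)
  ultimately have "\<forall>\<^sub>F n in sequentially. False"
    by eventually_elim auto
  then show False by simp
qed

lemma tendsto_of_dist_inverse_bound:
  fixes x y :: "nat \<Rightarrow> 'a::real_normed_vector"
  assumes "x \<longlonglongrightarrow> a" "\<And>n. dist (y n) (x n) < inverse (real (Suc n))"
  shows "y \<longlonglongrightarrow> a"
proof (rule Lim_transform[OF assms(1)])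
  show "(\<lambda>n. y n - x n) \<longlonglongrightarrow> 0"
    using LIMSEQ_inverse_real_of_nat
    by (rule Lim_null_comparison[rotated]) (use assms(2) in \<open>auto simp: dist_norm less_imp_le intro!: always_eventually\<close>)
qed

text \<open>A diagonal choice: each \<open>v n\<close> is itself a limit of regular subgradients at
  points approaching \<open>x n\<close> in position and in value, so one of them lies within
  \<open>1 / (n + 1)\<close> of \<open>x n\<close>, \<open>f (x n)\<close> and \<open>v n\<close> at
  once. The chosen sequence witnesses \<open>u\<close>. Convergence of the values is a hypothesis
  because \<open>f\<close> need not be continuous.\<close>

lemma limiting_subdiff_closed:
  fixes f :: "'a::real_inner \<Rightarrow> ereal"
  assumes x: "x \<longlonglongrightarrow> a" and fx: "(\<lambda>n. f (x n)) \<longlonglongrightarrow> f a" and fin: "\<bar>f a\<bar> \<noteq> \<infinity>"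
    and v: "\<And>n. v n \<in> limiting_subdiff f (x n)" "v \<longlonglongrightarrow> u"
  shows "u \<in> limiting_subdiff f a"
proof -
  have x_fin: "\<bar>f (x n)\<bar> \<noteq> \<infinity>" for n
    using v(1)[of n] by (simp add: limiting_subdiff_def)
  have "\<exists>y w. w \<in> regular_subdiff f y \<and> dist y (x n) < inverse (real (Suc n)) \<and>
      dist w (v n) < inverse (real (Suc n)) \<and>
      dist (real_of_ereal (f y)) (real_of_ereal (f (x n))) < inverse (real (Suc n))" for n
  proof -
    obtain y w where yw: "y \<longlonglongrightarrow> x n" "(\<lambda>k. f (y k)) \<longlonglongrightarrow> f (x n)"
        "\<And>k. w k \<in> regular_subdiff f (y k)" "w \<longlonglongrightarrow> v n"
      using v(1)[of n] by (auto simp: limiting_subdiff_def)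
    \<comment> \<open>The values involved are finite, so they can be compared as reals.\<close>
    have "(\<lambda>k. real_of_ereal (f (y k))) \<longlonglongrightarrow> real_of_ereal (f (x n))"
      using yw(2) x_fin[of n] by (intro lim_real_of_ereal) (simp add: ereal_real)
    note this[THEN tendstoD] yw(1)[THEN tendstoD] yw(4)[THEN tendstoD]
    from this[of "inverse (real (Suc n))"]
    have "\<forall>\<^sub>F k in sequentially. dist (y k) (x n) < inverse (real (Suc n)) \<and>
      dist (w k) (v n) < inverse (real (Suc n)) \<and>
      dist (real_of_ereal (f (y k))) (real_of_ereal (f (x n))) < inverse (real (Suc n))"
      by (simp add: eventually_conj_iff)
    then obtain k where "dist (y k) (x n) < inverse (real (Suc n)) \<and>
      dist (w k) (v n) < inverse (real (Suc n)) \<and>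
      dist (real_of_ereal (f (y k))) (real_of_ereal (f (x n))) < inverse (real (Suc n))"
      using eventually_happens'[OF sequentially_bot] by blast
    then show ?thesis using yw(3) by blast
  qed
  then obtain y w where yw: "\<And>n. w n \<in> regular_subdiff f (y n)"
      "\<And>n. dist (y n) (x n) < inverse (real (Suc n))"
      "\<And>n. dist (w n) (v n) < inverse (real (Suc n))"
      "\<And>n. dist (real_of_ereal (f (y n))) (real_of_ereal (f (x n))) < inverse (real (Suc n))"
    by metis
  have "y \<longlonglongrightarrow> a" "w \<longlonglongrightarrow> u"
    using tendsto_of_dist_inverse_bound[OF x yw(2)] tendsto_of_dist_inverse_bound[OF v(2) yw(3)] by auto
  moreover have "(\<lambda>n. f (y n)) \<longlonglongrightarrow> f a"
  proof -
    have "(\<lambda>n. real_of_ereal (f (x n))) \<longlonglongrightarrow> real_of_ereal (f a)"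
      using fx fin by (intro lim_real_of_ereal) (simp add: ereal_real)
    from tendsto_of_dist_inverse_bound[OF this yw(4)]
    have "(\<lambda>n. ereal (real_of_ereal (f (y n)))) \<longlonglongrightarrow> ereal (real_of_ereal (f a))" by simp
    moreover have "\<bar>f (y n)\<bar> \<noteq> \<infinity>" for n
      using yw(1)[of n] by (simp add: regular_subdiff_def)
    ultimately show ?thesis using fin by (simp add: ereal_real)
  qed
  ultimately show ?thesis using yw(1) fin by (auto simp: limiting_subdiff_def)
qed

lemma dist_zero_nonneg: "0 \<le> dist_zero S"
  unfolding dist_zero_def by (intro INF_greatest) simp

lemma dist_zero_lessE:
  assumes "dist_zero S < ereal c"
  obtains v where "v \<in> S" "norm v < c"
  using assms by (auto simp: dist_zero_def INF_less_iff)

text \<open>A real bound on \<open>dist_zero\<close> makes the subdifferential nonempty, since the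
  empty set has distance \<infinity>. Subgradients of norm below \<open>r + 1 / (n + 1)\<close> then
  tend to 0, and closedness carries 0 to the limit point; the slack avoids the question whether the
  infimum is attained.\<close>

lemma crit_limit:
  fixes f :: "'a::real_inner \<Rightarrow> ereal"
  assumes x: "x \<longlonglongrightarrow> a" and fx: "(\<lambda>n. f (x n)) \<longlonglongrightarrow> f a" and fin: "\<bar>f a\<bar> \<noteq> \<infinity>"
    and bound: "\<forall>\<^sub>F n in sequentially. dist_zero (limiting_subdiff f (x n)) \<le> ereal (r n)"
    and r: "r \<longlonglongrightarrow> 0"
  shows "a \<in> crit f"
proof -
  obtain N where N: "\<And>n. n \<ge> N \<Longrightarrow> dist_zero (limiting_subdiff f (x n)) \<le> ereal (r n)"
    using bound by (auto simp: eventually_sequentially)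
  have "\<exists>v \<in> limiting_subdiff f (x (n + N)). norm v < r (n + N) + inverse (real (Suc n))" for n
  proof -
    have "dist_zero (limiting_subdiff f (x (n + N))) < ereal (r (n + N) + inverse (real (Suc n)))"
      using N[of "n + N"] by (rule le_less_trans) auto
    then show ?thesis by (rule dist_zero_lessE) blast
  qed
  then obtain v where v: "\<And>n. v n \<in> limiting_subdiff f (x (n + N))"
      "\<And>n. norm (v n) < r (n + N) + inverse (real (Suc n))"
    by metis
  have "(\<lambda>n. r (n + N) + inverse (real (Suc n))) \<longlonglongrightarrow> 0 + 0"
    by (rule tendsto_add[OF LIMSEQ_ignore_initial_segment[OF r] LIMSEQ_inverse_real_of_nat])
  then have "(\<lambda>n. r (n + N) + inverse (real (Suc n))) \<longlonglongrightarrow> 0" by simp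
  then have "v \<longlonglongrightarrow> 0"
    by (rule Lim_null_comparison[rotated]) (intro always_eventually allI less_imp_le v(2))
  then have "0 \<in> limiting_subdiff f a"
    by (rule limiting_subdiff_closed[OF LIMSEQ_ignore_initial_segment[OF x] LIMSEQ_ignore_initial_segment[OF fx] fin v(1)])
  then show ?thesis by (simp add: crit_def)
qed

text \<open>A weight \<open>w\<close> plays the role of the derivative of a desingularizing function \<open>\<phi>\<close>; the tangent
  inequality, imposed on the whole half-line with \<open>w\<close> possibly truncated to \<open>0\<close>, is all that is
  used of the concavity of \<open>\<phi>\<close>.\<close>

definition KL_weight :: "(real \<Rightarrow> real) \<Rightarrow> bool" where
  "KL_weight w \<longleftrightarrow> w \<in> borel_measurable borel \<and> w 0 = 0 \<and> (\<forall>x\<ge>0. 0 \<le> w x) \<and>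
     (\<exists>\<phi> B. \<phi> \<in> borel_measurable borel \<and> \<phi> 0 = 0 \<and> (\<forall>y\<ge>0. 0 \<le> \<phi> y \<and> \<phi> y \<le> B) \<and>
        (\<forall>x>0. \<forall>y\<ge>0. \<phi> y \<le> \<phi> x + w x * (y - x)))"

text \<open>A desingularizing function known only near 0 yields a weight on the half-line:
  \<open>\<psi>\<close> is frozen at its end values outside \<open>[0, c]\<close>. This keeps it
  bounded by \<open>\<psi> c\<close>, and slope 0 is correct from \<open>c\<close> on because
  nonnegative slopes make \<open>\<psi>\<close> nondecreasing.\<close>

lemma KL_weight_cutoff:
  fixes \<psi> \<psi>' :: "real \<Rightarrow> real"
  assumes c: "0 < c" and \<psi>: "\<psi> 0 = 0" "continuous_on {0..c} \<psi>"
    and \<psi>': "continuous_on {0<..<c} \<psi>'" "\<And>x. 0 < x \<Longrightarrow> x \<le> c \<Longrightarrow> 0 \<le> \<psi>' x"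
    and tangent: "\<And>x y. 0 < x \<Longrightarrow> x \<le> c \<Longrightarrow> 0 \<le> y \<Longrightarrow> y \<le> c \<Longrightarrow> \<psi> y \<le> \<psi> x + \<psi>' x * (y - x)"
  shows "KL_weight (\<lambda>t. if t \<in> {0<..<c} then \<psi>' t else 0)"
proof -
  \<comment> \<open>The tangent at the larger point \<open>x\<close> lies above
    \<open>\<psi>\<close> and has nonnegative slope.\<close>
  have mono: "\<psi> y \<le> \<psi> x" if "0 \<le> y" "y \<le> x" "x \<le> c" for x y
  proof (cases "x = 0")
    case False
    then have "\<psi> y \<le> \<psi> x + \<psi>' x * (y - x)" using that by (intro tangent) auto
    moreover have "\<psi>' x * (y - x) \<le> 0"
      using \<psi>'(2)[of x] that False by (intro mult_nonneg_nonpos) auto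
    ultimately show ?thesis by simp
  qed (use that in auto)
  define \<phi> where "\<phi> y = \<psi> (min (max 0 y) c)" for y
  have "continuous_on UNIV \<phi>"
    unfolding \<phi>_def[abs_def] using c
    by (intro continuous_on_compose2[OF \<psi>(2)] continuous_on_min continuous_on_max
        continuous_on_const continuous_on_id) auto
  then have 1: "\<phi> \<in> borel_measurable borel"
    by (rule borel_measurable_continuous_onI)
  have 2: "(\<lambda>t. if t \<in> {0<..<c} then \<psi>' t else 0) \<in> borel_measurable borel"
    using \<psi>'(1) by (intro borel_measurable_continuous_on_if) auto
  have 3: "\<phi> 0 = 0" using \<psi>(1) c by (simp add: \<phi>_def)
  have 4: "0 \<le> \<phi> y \<and> \<phi> y \<le> \<psi> c" if "0 \<le> y" for y
    using mono[of 0 "min y c"] mono[of "min y c" c] that c \<psi>(1) by (auto simp: \<phi>_def)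
  have 5: "\<phi> y \<le> \<phi> x + (if x \<in> {0<..<c} then \<psi>' x else 0) * (y - x)" if "0 < x" "0 \<le> y" for x y
  proof (cases "x < c")
    case False
    then show ?thesis using mono[of "min y c" c] that c by (simp add: \<phi>_def)
  next
    case True
    have "\<psi> (min y c) \<le> \<psi> x + \<psi>' x * (min y c - x)"
      using that True c by (intro tangent) auto
    \<comment> \<open>Replacing \<open>min y c\<close> by \<open>y\<close> only raises the right
      side, the slope being nonnegative.\<close>
    also have "\<dots> \<le> \<psi> x + \<psi>' x * (y - x)"
      using \<psi>'(2)[of x] that True by (intro add_left_mono mult_left_mono) auto
    finally show ?thesis using that True by (simp add: \<phi>_def)
  qed
  show ?thesis
    unfolding KL_weight_def
  proof (intro conjI exI[of _ \<phi>] exI[of _ "\<psi> c"])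
    show "\<forall>x\<ge>0. 0 \<le> (if x \<in> {0<..<c} then \<psi>' x else 0)"
      using \<psi>'(2) by auto
    show "(if 0 \<in> {0<..<c} then \<psi>' 0 else 0) = 0"
      by simp
    show "\<forall>y\<ge>0. 0 \<le> \<phi> y \<and> \<phi> y \<le> \<psi> c"
      using 4 by blast
    show "\<forall>x>0. \<forall>y\<ge>0. \<phi> y \<le> \<phi> x + (if x \<in> {0<..<c} then \<psi>' x else 0) * (y - x)"
      using 5 by blast
  qed (fact 1 2 3)+
qed

text \<open>The tangent inequality of the primitive \<open>t powr (1 - p) / (1 - p)\<close> is
  Young's inequality for \<open>y powr (1 - p) * x powr p\<close>, divided by
  \<open>x powr p\<close>. The exponents 1/2 and \<open>q\<close> will serve the quadratic part and
  the tail part of the Lyapunov gap.\<close>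

lemma KL_weight_powr:
  assumes p: "0 < p" "p < 1"
  shows "KL_weight (\<lambda>t. if t \<in> {0<..<1} then t powr (- p) else 0)"
proof (rule KL_weight_cutoff[where \<psi> = "\<lambda>t. t powr (1 - p) / (1 - p)"])
  show "continuous_on {0..1} (\<lambda>t. t powr (1 - p) / (1 - p))"
    using p by (intro continuous_intros continuous_on_powr') auto
  show "continuous_on {0<..<1::real} (\<lambda>t. t powr (- p))"
    by (intro continuous_intros) auto
  fix x y :: real assume x: "0 < x" and y: "0 \<le> y"
  have xp: "x powr (1 - p) = x powr (- p) * x"
    using x powr_add[of x "- p" 1] by simp
  have "y powr (1 - p) \<le> x powr (- p) * ((1 - p) * y + p * x)"
  proof (cases "y = 0")
    case False
    have "y powr (1 - p) = x powr (- p) * (y powr (1 - p) * x powr p)"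
      using x by (simp add: powr_minus)
    also have "\<dots> \<le> x powr (- p) * ((1 - p) * y + p * x)"
      using x y p False by (intro mult_left_mono Youngs_inequality_0) auto
    finally show ?thesis .
  qed (use x p in auto)
  then have "y powr (1 - p) / (1 - p) \<le> x powr (- p) * ((1 - p) * y + p * x) / (1 - p)"
    using p by (intro divide_right_mono) auto
  also have "\<dots> = x powr (1 - p) / (1 - p) + x powr (- p) * (y - x)"
    unfolding xp using p by (simp add: field_simps)
  finally show "y powr (1 - p) / (1 - p) \<le> x powr (1 - p) / (1 - p) + x powr (- p) * (y - x)" .
qed (use p in auto)

text \<open>With the weight \<open>\<phi>' (t / 3)\<close>, the function gap \<open>s\<close> may be replaced by any larger gap
  \<open>t \<le> 3 * s\<close>, because \<open>\<phi>'\<close> is antitone.\<close>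

lemma KL_at_weight:
  fixes f :: "'a::real_inner \<Rightarrow> ereal"
  assumes "KL_at f z" and fz: "f z = ereal c"
  shows "\<exists>w \<delta> \<epsilon>. KL_weight w \<and> 0 < \<delta> \<and> 0 < \<epsilon> \<and>
    (\<forall>x s t. dist x z < \<delta> \<longrightarrow> f x = ereal (c + s) \<longrightarrow> 0 < s \<longrightarrow> s \<le> t \<longrightarrow> t \<le> 3 * s \<longrightarrow> t < \<epsilon> \<longrightarrow>
       1 \<le> ereal (w t) * dist_zero (limiting_subdiff f x))"
proof -
  obtain \<epsilon> \<delta> \<phi> \<phi>' where \<phi>: "continuous_on {0..<\<epsilon>} \<phi>" "concave_on {0..<\<epsilon>} \<phi>" "\<phi> 0 = 0"
    and \<phi>': "\<forall>t\<in>{0<..<\<epsilon>}. (\<phi> has_real_derivative \<phi>' t) (at t)"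
        "continuous_on {0<..<\<epsilon>} \<phi>'" "\<forall>t\<in>{0<..<\<epsilon>}. 0 < \<phi>' t"
    and KL: "\<forall>x. norm (x - z) < \<delta> \<and> f z < f x \<and> f x < f z + ereal \<epsilon> \<longrightarrow>
             1 \<le> ereal (\<phi>' (real_of_ereal (f x - f z))) * dist_zero (limiting_subdiff f x)"
    and \<epsilon>: "0 < \<epsilon>" and \<delta>: "0 < \<delta>"
    using assms(1) unfolding KL_at_def by (elim conjE exE) (rule that; assumption)
  have tangent: "\<phi> y \<le> \<phi> x + \<phi>' x * (y - x)" if "x \<in> {0<..<\<epsilon>}" "y \<in> {0..<\<epsilon>}" for x y
  proof -
    have "- \<phi>' x * (y - x) \<le> - \<phi> y - - \<phi> x"
    proof (rule convex_on_imp_above_tangent[where A = "{0..<\<epsilon>}"])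
      show "convex_on {0..<\<epsilon>} (\<lambda>t. - \<phi> t)"
        using \<phi>(2) by (simp add: concave_on_def)
      show "((\<lambda>t. - \<phi> t) has_real_derivative - \<phi>' x) (at x within {0..<\<epsilon>})"
        by (rule DERIV_minus[OF has_field_derivative_at_within[OF \<phi>'(1)[rule_format, OF that(1)]]])
      show "x \<in> interior {0..<\<epsilon>}" 
        using that(1) by simp
    qed (use that in auto)
    then show ?thesis by simp
  qed
  have antimono: "\<phi>' y \<le> \<phi>' x" if "0 < x" "x \<le> y" "y < \<epsilon>" for x y
  proof (cases "x = y")
    case False
    \<comment> \<open>Added up, the two tangent inequalities lose the values of
      \<open>\<phi>\<close> and leave a comparison of slopes.\<close>
    have "\<phi> y \<le> \<phi> x + \<phi>' x * (y - x)" "\<phi> x \<le> \<phi> y + \<phi>' y * (x - y)"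
      using that by (auto intro!: tangent)
    then have "\<phi>' y * (y - x) \<le> \<phi>' x * (y - x)" by (simp add: algebra_simps)
    then show ?thesis using that False by simp
  qed simp
  \<comment> \<open>The primitive of \<open>\<phi>' (t / 3)\<close> is
    \<open>3 * \<phi> (t / 3)\<close>. The cutoff at \<open>\<epsilon>/2\<close> keeps the closed
    interval required by \<open>KL_weight_cutoff\<close> inside the domain of \<open>\<phi>\<close>,
    and the gap \<open>s \<le> t\<close> below \<epsilon>.\<close>
  define w where "w = (\<lambda>t. if t \<in> {0<..<\<epsilon>/2} then \<phi>' (t / 3) else 0)"
  have "KL_weight w"
    unfolding w_def
  proof (rule KL_weight_cutoff[where \<psi> = "\<lambda>t. 3 * \<phi> (t / 3)"])
    show "continuous_on {0..\<epsilon>/2} (\<lambda>t. 3 * \<phi> (t / 3))"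
      using \<epsilon> by (intro continuous_intros continuous_on_compose2[OF \<phi>(1)]) auto
    show "continuous_on {0<..<\<epsilon>/2} (\<lambda>t. \<phi>' (t / 3))"
      using \<epsilon> by (intro continuous_intros continuous_on_compose2[OF \<phi>'(2)]) auto
    show "0 \<le> \<phi>' (x / 3)" if "0 < x" "x \<le> \<epsilon>/2" for x
      using \<phi>'(3)[rule_format, of "x / 3"] that \<epsilon> by auto
    show "3 * \<phi> (y / 3) \<le> 3 * \<phi> (x / 3) + \<phi>' (x / 3) * (y - x)"
      if "0 < x" "x \<le> \<epsilon>/2" "0 \<le> y" "y \<le> \<epsilon>/2" for x y
      using tangent[of "x / 3" "y / 3"] that \<epsilon> by (auto simp: algebra_simps)
  qed (use \<epsilon> \<phi>(3) in auto)
  moreover have "1 \<le> ereal (w t) * dist_zero (limiting_subdiff f x)"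
    if "dist x z < \<delta>" "f x = ereal (c + s)" "0 < s" "s \<le> t" "t \<le> 3 * s" "t < \<epsilon>/2" for x s t
  proof -
    have "1 \<le> ereal (\<phi>' s) * dist_zero (limiting_subdiff f x)"
      using KL[rule_format, of x] that \<epsilon> by (simp add: dist_norm fz)
    also have "\<dots> \<le> ereal (w t) * dist_zero (limiting_subdiff f x)"
      using antimono[of "t / 3" s] that \<epsilon>
      by (intro ereal_mult_right_mono dist_zero_nonneg) (auto simp: w_def)
    finally show ?thesis .
  qed
  ultimately show ?thesis
    using \<epsilon> \<delta> by (intro exI[of _ w] exI[of _ \<delta>] exI[of _ "\<epsilon>/2"]) auto
qed

text \<open>Finitely many KL neighbourhoods cover the compact set. Their weights are not merged into
  a single desingularizing function: which one applies may depend on \<open>x\<close>, and a finite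
  set suffices because the weighted sums can be shown finite for each weight separately.\<close>

lemma KL_uniformize:
  fixes f :: "'a::real_inner \<Rightarrow> ereal"
  assumes "compact K" and KL: "\<And>z. z \<in> K \<Longrightarrow> KL_at f z" and fK: "\<And>z. z \<in> K \<Longrightarrow> f z = ereal c"
  obtains W U \<epsilon> where "finite W" "\<And>w. w \<in> W \<Longrightarrow> KL_weight w" "open U" "K \<subseteq> U" "0 < \<epsilon>"
    "\<And>x s t. x \<in> U \<Longrightarrow> f x = ereal (c + s) \<Longrightarrow> 0 < s \<Longrightarrow> s \<le> t \<Longrightarrow> t \<le> 3 * s \<Longrightarrow> t < \<epsilon> \<Longrightarrow>
       \<exists>w\<in>W. 1 \<le> ereal (w t) * dist_zero (limiting_subdiff f x)"
proof -
  define G where "G z w \<delta> \<epsilon> \<longleftrightarrow> KL_weight w \<and> 0 < \<delta> \<and> 0 < \<epsilon> \<and>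
    (\<forall>x s t. dist x z < \<delta> \<longrightarrow> f x = ereal (c + s) \<longrightarrow> 0 < s \<longrightarrow> s \<le> t \<longrightarrow> t \<le> 3 * s \<longrightarrow> t < \<epsilon> \<longrightarrow>
       1 \<le> ereal (w t) * dist_zero (limiting_subdiff f x))" for z w \<delta> \<epsilon>
  have "\<exists>w \<delta> \<epsilon>. G z w \<delta> \<epsilon>" if "z \<in> K" for z
    using KL_at_weight[OF KL[OF that] fK[OF that]] by (simp add: G_def)
  then obtain w \<delta> \<epsilon> where G: "\<And>z. z \<in> K \<Longrightarrow> G z (w z) (\<delta> z) (\<epsilon> z)"
    by metis
  then have w: "\<And>z. z \<in> K \<Longrightarrow> KL_weight (w z)" and \<delta>: "\<And>z. z \<in> K \<Longrightarrow> 0 < \<delta> z"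
    and \<epsilon>: "\<And>z. z \<in> K \<Longrightarrow> 0 < \<epsilon> z"
    and KLw: "\<And>z x s t. z \<in> K \<Longrightarrow> dist x z < \<delta> z \<Longrightarrow> f x = ereal (c + s) \<Longrightarrow> 0 < s \<Longrightarrow> s \<le> t \<Longrightarrow>
       t \<le> 3 * s \<Longrightarrow> t < \<epsilon> z \<Longrightarrow> 1 \<le> ereal (w z t) * dist_zero (limiting_subdiff f x)"
    unfolding G_def by blast+
  obtain C where C: "C \<subseteq> K" "finite C" "K \<subseteq> (\<Union>z\<in>C. ball z (\<delta> z))"
  proof -
    have "K \<subseteq> (\<Union>z\<in>K. ball z (\<delta> z))" using \<delta> by force
    from compactE_image[OF assms(1) open_ball this] show thesis using that by metis
  qed
  \<comment> \<open>The inserted 1 keeps the minimum meaningful when \<open>C\<close> is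
    empty.\<close>
  define e where "e = Min (insert 1 (\<epsilon> ` C))"
  have e: "0 < e" "\<And>z. z \<in> C \<Longrightarrow> e \<le> \<epsilon> z"
    using C \<epsilon> by (auto simp: e_def)
  show ?thesis
  proof (rule that[of "w ` C" "\<Union>z\<in>C. ball z (\<delta> z)" e])
    fix x s t
    assume *: "x \<in> (\<Union>z\<in>C. ball z (\<delta> z))" "f x = ereal (c + s)" "0 < s" "s \<le> t" "t \<le> 3 * s" "t < e"
    then obtain z where z: "z \<in> C" "dist x z < \<delta> z" by (auto simp: dist_commute)
    then show "\<exists>w\<in>w ` C. 1 \<le> ereal (w t) * dist_zero (limiting_subdiff f x)"
      using KLw[of z x s t] * C(1) e(2)[OF z(1)] by auto
  next
    show "\<And>v. v \<in> w ` C \<Longrightarrow> KL_weight v" using C(1) w by blast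
  qed (use C(2,3) e(1) in \<open>simp_all add: open_UN\<close>)
qed

section \<open>Nonnegative supermartingales\<close>

text \<open>Doob's strategy: a position is opened by a value below \<open>a\<close> and held until a
  value above \<open>b\<close>. The state at \<open>n\<close> depends on \<open>y 0\<close>, ...,
  \<open>y n\<close> only, so it is known before the increment from \<open>n\<close> to
  \<open>n + 1\<close> on which it bets.\<close>

fun in_upcrossing :: "real \<Rightarrow> real \<Rightarrow> (nat \<Rightarrow> real) \<Rightarrow> nat \<Rightarrow> bool" where
  "in_upcrossing a b y 0 \<longleftrightarrow> y 0 < a"
| "in_upcrossing a b y (Suc n) \<longleftrightarrow> (if in_upcrossing a b y n then y (Suc n) \<le> b else y (Suc n) < a)"

definition ends_upcrossing :: "real \<Rightarrow> real \<Rightarrow> (nat \<Rightarrow> real) \<Rightarrow> nat \<Rightarrow> bool" where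
  "ends_upcrossing a b y n \<longleftrightarrow> in_upcrossing a b y n \<and> \<not> in_upcrossing a b y (Suc n)"

text \<open>Each completed upcrossing is bought below \<open>a\<close> and sold above
  \<open>b\<close>, so it earns at least \<open>b - a\<close>. The term \<open>y n - a\<close>
  accounts for a position still open at time \<open>n\<close>; with it the induction closes in every
  case of the state change.\<close>

lemma upcrossing_gain:
  assumes "a < b"
  shows "(b - a) * (\<Sum>j<n. of_bool (ends_upcrossing a b y j)) +
           (if in_upcrossing a b y n then y n - a else 0)
         \<le> (\<Sum>j<n. of_bool (in_upcrossing a b y j) * (y (Suc j) - y j))"
proof (induction n)
  case (Suc n)
  define E where "E j = (of_bool (ends_upcrossing a b y j) :: real)" for j
  define I where "I j = (of_bool (in_upcrossing a b y j) :: real)" for j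
  show ?case
    using Suc assms unfolding sum.lessThan_Suc E_def[symmetric] I_def[symmetric]
    by (auto simp: E_def[of n] I_def[of n] ends_upcrossing_def algebra_simps split: if_splits)
qed simp

text \<open>After the last completed upcrossing, a visit below \<open>a\<close> opens a position
  that is never closed, so the sequence stays at or below \<open>b\<close> from then on.\<close>

lemma not_oscillating_if_finitely_many_upcrossings:
  assumes "finite {n. ends_upcrossing a b y n}"
  shows "\<not> ((\<exists>\<^sub>F n in sequentially. y n < a) \<and> (\<exists>\<^sub>F n in sequentially. b < y n))"
proof
  assume osc: "(\<exists>\<^sub>F n in sequentially. y n < a) \<and> (\<exists>\<^sub>F n in sequentially. b < y n)"
  obtain N where N: "\<And>n. n \<ge> N \<Longrightarrow> \<not> ends_upcrossing a b y n"
    using assms unfolding finite_nat_set_iff_bounded by (metis mem_Collect_eq not_less)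
  have freq: "\<exists>n>K. P (y n)" if "\<exists>\<^sub>F n in sequentially. P (y n)" for P K
    using that unfolding frequently_def eventually_sequentially by (meson Suc_le_lessD)
  obtain n0 where n0: "n0 > N" "y n0 < a"
    using osc freq[of "\<lambda>z. z < a"] by blast
  show False
  proof (cases "in_upcrossing a b y n0")
    case False
    \<comment> \<open>Lying below \<open>a\<close> without holding a position means that an
      upcrossing ends exactly at \<open>n0\<close>. It is indexed by the predecessor of
      \<open>n0\<close>, hence the strict inequality \<open>n0 > N\<close>.\<close>
    then obtain n' where n': "n0 = Suc n'"
      using n0 by (cases n0) auto
    then have "in_upcrossing a b y n'" "\<not> in_upcrossing a b y n0"
      using False n0 by (auto split: if_splits)
    then show False using N[of n'] n0 n' by (auto simp: ends_upcrossing_def)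
  next
    case True
    have *: "in_upcrossing a b y n" if "n \<ge> n0" for n
      using that
    proof (induction n rule: dec_induct)
      case (step n)
      then show ?case using N[of n] n0(1) unfolding ends_upcrossing_def by auto
    qed (rule True)
    obtain n1 where n1: "n1 > n0" "b < y n1"
      using osc freq[of "\<lambda>z. z > b"] by blast
    then obtain k where "n1 = Suc k" "k \<ge> n0" by (cases n1) auto
    then show False using *[of k] *[of n1] n1 by auto
  qed
qed

text \<open>The supermartingale inequality is stated in integrated form over the events of
  \<open>F k\<close>, which is how it is used throughout. The decrease \<open>Z k\<close> is only
  integrable, not adapted, since in the application it contains quantities of time
  \<open>k + 1\<close>.\<close>

locale nonneg_supermartingale = prob_space M for M :: "'w measure" +
  fixes F :: "nat \<Rightarrow> 'w measure" and Y Z :: "nat \<Rightarrow> 'w \<Rightarrow> real"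
  assumes subalg: "\<And>k. subalgebra M (F k)"
    and sets_mono: "\<And>i j. i \<le> j \<Longrightarrow> sets (F i) \<subseteq> sets (F j)"
    and adapted: "\<And>k. Y k \<in> borel_measurable (F k)"
    and integrable_Y: "\<And>k. integrable M (Y k)"
    and integrable_Z: "\<And>k. integrable M (Z k)"
    and Y_nonneg: "\<And>k. AE \<omega> in M. 0 \<le> Y k \<omega>"
    and Z_nonneg: "\<And>k \<omega>. \<omega> \<in> space M \<Longrightarrow> 0 \<le> Z k \<omega>"
    and decrease: "\<And>k A. A \<in> sets (F k) \<Longrightarrow>
      (\<integral>\<omega>. indicator A \<omega> * (Y (Suc k) \<omega> + Z k \<omega>) \<partial>M) \<le> (\<integral>\<omega>. indicator A \<omega> * Y k \<omega> \<partial>M)"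
begin

section \<open>Telescoped expectations and summability of the decrease\<close>

lemma space_F [simp]: "space (F k) = space M"
  using subalg[of k] by (simp add: subalgebra_def)

lemma sets_F: "A \<in> sets (F k) \<Longrightarrow> A \<in> sets M"
  using subalg[of k] by (auto simp: subalgebra_def)

lemma measurable_M_of_F: "f \<in> measurable (F k) N \<Longrightarrow> f \<in> measurable M N"
  using measurable_from_subalg[OF subalg] .

lemma measurable_F_mono:
  assumes "i \<le> j" "f \<in> measurable (F i) N"
  shows "f \<in> measurable (F j) N"
  using measurable_from_subalg[of "F j" "F i" f N] assms sets_mono[of i j]
  by (simp add: subalgebra_def)

lemma measurable_Y [measurable]: "Y k \<in> borel_measurable M"
  using adapted by (rule measurable_M_of_F)

lemma measurable_Z [measurable]: "Z k \<in> borel_measurable M"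
  using integrable_Z by auto

lemma integrable_indicator_mult:
  fixes f :: "'w \<Rightarrow> real"
  assumes "A \<in> sets M" "integrable M f"
  shows "integrable M (\<lambda>\<omega>. indicator A \<omega> * f \<omega>)"
  using integrable_mult_indicator[OF assms] by simp

lemma decrease_iterated:
  assumes A: "A \<in> sets (F k)" and "k \<le> n"
  shows "(\<integral>\<omega>. indicator A \<omega> * Y n \<omega> \<partial>M) \<le> (\<integral>\<omega>. indicator A \<omega> * Y k \<omega> \<partial>M)"
  using \<open>k \<le> n\<close>
proof (induction n rule: dec_induct)
  case (step n)
  have An: "A \<in> sets (F n)" using sets_mono[OF step(1)] A by auto
  note AM = sets_F[OF A]
  have "(\<integral>\<omega>. indicator A \<omega> * Y (Suc n) \<omega> \<partial>M) \<le> (\<integral>\<omega>. indicator A \<omega> * (Y (Suc n) \<omega> + Z n \<omega>) \<partial>M)"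
    using AM Z_nonneg
    by (intro integral_mono integrable_indicator_mult integrable_Y integrable_Z Bochner_Integration.integrable_add)
       (auto simp: indicator_def)
  also have "\<dots> \<le> (\<integral>\<omega>. indicator A \<omega> * Y n \<omega> \<partial>M)" by (rule decrease[OF An])
  finally show ?case using step by simp
qed simp

lemma sum_integral_Z_le: "(\<Sum>k<n. \<integral>\<omega>. Z k \<omega> \<partial>M) + (\<integral>\<omega>. Y n \<omega> \<partial>M) \<le> (\<integral>\<omega>. Y 0 \<omega> \<partial>M)"
proof (induction n)
  case (Suc n)
  have eq: "(\<integral>\<omega>. indicator (space M) \<omega> * f \<omega> \<partial>M) = (\<integral>\<omega>. f \<omega> \<partial>M)" for f :: "'w \<Rightarrow> real"
    by (intro Bochner_Integration.integral_cong) auto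
  have "space M \<in> sets (F n)" using sets.top[of "F n"] by simp
  from decrease[OF this] have "(\<integral>\<omega>. Y (Suc n) \<omega> \<partial>M) + (\<integral>\<omega>. Z n \<omega> \<partial>M) \<le> (\<integral>\<omega>. Y n \<omega> \<partial>M)"
    unfolding eq by (simp add: integrable_Y integrable_Z)
  with Suc show ?case by simp
qed simp

text \<open>The telescoped expectations bound the expectation of the whole series by that of
  \<open>Y 0\<close>, and a nonnegative variable of finite expectation is finite almost
  surely.\<close>

lemma AE_summable_Z: "AE \<omega> in M. summable (\<lambda>k. Z k \<omega>)"
proof -
  have "(\<integral>\<^sup>+\<omega>. (\<Sum>k. ennreal (Z k \<omega>)) \<partial>M) = (\<Sum>k. \<integral>\<^sup>+\<omega>. ennreal (Z k \<omega>) \<partial>M)"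
    by (intro nn_integral_suminf) simp
  also have "\<dots> = (\<Sum>k. ennreal (\<integral>\<omega>. Z k \<omega> \<partial>M))"
    by (intro suminf_cong nn_integral_eq_integral integrable_Z) (auto simp: Z_nonneg)
  also have "\<dots> \<le> ennreal (\<integral>\<omega>. Y 0 \<omega> \<partial>M)"
  proof (rule suminf_le_const)
    fix n
    have Z0: "0 \<le> (\<integral>\<omega>. Z k \<omega> \<partial>M)" for k
      by (intro integral_nonneg_AE) (auto simp: Z_nonneg)
    have "0 \<le> (\<integral>\<omega>. Y n \<omega> \<partial>M)"
      by (intro integral_nonneg_AE Y_nonneg)
    then show "(\<Sum>k<n. ennreal (\<integral>\<omega>. Z k \<omega> \<partial>M)) \<le> ennreal (\<integral>\<omega>. Y 0 \<omega> \<partial>M)"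
      using sum_integral_Z_le[of n] by (simp add: sum_ennreal Z0 ennreal_leI)
  qed simp
  finally have "(\<integral>\<^sup>+\<omega>. (\<Sum>k. ennreal (Z k \<omega>)) \<partial>M) \<noteq> \<infinity>"
    by (auto simp: top_unique)
  then have "AE \<omega> in M. (\<Sum>k. ennreal (Z k \<omega>)) \<noteq> \<infinity>"
    by (intro nn_integral_PInf_AE) simp
  then show ?thesis
    using AE_space by eventually_elim (auto intro: summable_suminf_not_top Z_nonneg)
qed

section \<open>Almost sure convergence by counting upcrossings\<close>

lemma in_upcrossing_measurable:
  "Measurable.pred (F n) (\<lambda>\<omega>. in_upcrossing a b (\<lambda>k. Y k \<omega>) n)"
proof (induction n)
  case 0
  note [measurable] = adapted
  show ?case by simp
next
  case (Suc n)
  note [measurable] = adapted measurable_F_mono[OF _ Suc, of "Suc n", simplified]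
  show ?case by simp
qed

lemma ends_upcrossing_measurable [measurable]:
  "Measurable.pred M (\<lambda>\<omega>. ends_upcrossing a b (\<lambda>k. Y k \<omega>) n)"
  unfolding ends_upcrossing_def
  using measurable_M_of_F[OF in_upcrossing_measurable] by measurable

text \<open>The betting strategy has nonpositive expected gain, and an open position loses at most
  \<open>\<bar>a\<bar>\<close> because \<open>Y\<close> is nonnegative. Hence the expected number of
  upcrossings completed up to time \<open>n\<close> is at most
  \<open>\<bar>a\<bar> / (b - a)\<close>, uniformly in \<open>n\<close>.\<close>

lemma AE_finite_upcrossings:
  assumes "a < b"
  shows "AE \<omega> in M. finite {n. ends_upcrossing a b (\<lambda>k. Y k \<omega>) n}"
proof -
  define E where "E n \<omega> = (of_bool (ends_upcrossing a b (\<lambda>k. Y k \<omega>) n) :: real)" for n \<omega>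
  have E_nonneg: "0 \<le> E n \<omega>" and E_le_1: "E n \<omega> \<le> 1" for n \<omega>
    by (auto simp: E_def)
  have E_sum_le: "\<bar>\<Sum>j<n. E j \<omega>\<bar> \<le> real n" for n \<omega>
    using sum_bounded_above[of "{..<n}" "\<lambda>j. E j \<omega>" 1] E_le_1 by (simp add: sum_nonneg E_nonneg)
  define I where "I n \<omega> = (of_bool (in_upcrossing a b (\<lambda>k. Y k \<omega>) n) :: real)" for n \<omega>
  have [measurable]: "E n \<in> borel_measurable M" for n
    unfolding E_def by measurable
  \<comment> \<open>The stake is the indicator of an event of \<open>F n\<close>, so the
    supermartingale inequality applies on that event.\<close>
  have I_ind: "\<exists>A\<in>sets (F n). \<forall>\<omega>\<in>space M. I n \<omega> = indicator A \<omega>" for n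
    using in_upcrossing_measurable[where n = n and a = a and b = b]
    by (intro bexI[of _ "{\<omega>\<in>space (F n). in_upcrossing a b (\<lambda>k. Y k \<omega>) n}"])
       (auto simp: I_def pred_def)
  have I_int: "integrable M (\<lambda>\<omega>. I n \<omega> * (Y (Suc n) \<omega> - Y n \<omega>))"
    and I_le: "(\<integral>\<omega>. I n \<omega> * (Y (Suc n) \<omega> - Y n \<omega>) \<partial>M) \<le> 0" for n
  proof -
    obtain A where A: "A \<in> sets (F n)" "\<forall>\<omega>\<in>space M. I n \<omega> = indicator A \<omega>"
      using I_ind by blast
    note AM = sets_F[OF A(1)]
    have "integrable M (\<lambda>\<omega>. indicator A \<omega> * (Y (Suc n) \<omega> - Y n \<omega>))"
      by (intro integrable_indicator_mult AM Bochner_Integration.integrable_diff integrable_Y)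
    then show "integrable M (\<lambda>\<omega>. I n \<omega> * (Y (Suc n) \<omega> - Y n \<omega>))"
      using A(2) by (subst Bochner_Integration.integrable_cong) auto
    have "(\<integral>\<omega>. I n \<omega> * (Y (Suc n) \<omega> - Y n \<omega>) \<partial>M)
        = (\<integral>\<omega>. indicator A \<omega> * Y (Suc n) \<omega> - indicator A \<omega> * Y n \<omega> \<partial>M)"
      using A(2) by (intro Bochner_Integration.integral_cong) (auto simp: algebra_simps)
    also have "\<dots> \<le> 0"
      using decrease_iterated[OF A(1), of "Suc n"] AM
      by (simp add: integrable_indicator_mult integrable_Y)
    finally show "(\<integral>\<omega>. I n \<omega> * (Y (Suc n) \<omega> - Y n \<omega>) \<partial>M) \<le> 0" .
  qed
  have "AE \<omega> in M. \<forall>k. 0 \<le> Y k \<omega>"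
    by (simp add: AE_all_countable Y_nonneg)
  then have bound: "AE \<omega> in M. (\<Sum>j<n. E j \<omega>) \<le> ((\<Sum>j<n. I j \<omega> * (Y (Suc j) \<omega> - Y j \<omega>)) + \<bar>a\<bar>) / (b - a)" for n
  proof eventually_elim
    case (elim \<omega>)
    have "(b - a) * (\<Sum>j<n. E j \<omega>) - \<bar>a\<bar> \<le> (\<Sum>j<n. I j \<omega> * (Y (Suc j) \<omega> - Y j \<omega>))"
      using upcrossing_gain[OF assms, of "\<lambda>k. Y k \<omega>" n] elim[rule_format, of n]
      unfolding E_def I_def by (auto split: if_splits)
    then show ?case
      using assms by (simp add: field_simps)
  qed
  have "(\<integral>\<^sup>+\<omega>. (\<Sum>n. ennreal (E n \<omega>)) \<partial>M) = (\<Sum>n. \<integral>\<^sup>+\<omega>. ennreal (E n \<omega>) \<partial>M)"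
    by (intro nn_integral_suminf) simp
  also have "\<dots> \<le> ennreal (\<bar>a\<bar> / (b - a))"
  proof (rule suminf_le_const)
    fix n
    have "(\<Sum>j<n. \<integral>\<^sup>+\<omega>. ennreal (E j \<omega>) \<partial>M) = (\<integral>\<^sup>+\<omega>. ennreal (\<Sum>j<n. E j \<omega>) \<partial>M)"
      by (subst nn_integral_sum[symmetric]) (auto simp: E_def sum_ennreal intro!: nn_integral_cong)
    also have "\<dots> = ennreal (\<integral>\<omega>. (\<Sum>j<n. E j \<omega>) \<partial>M)"
      by (intro nn_integral_eq_integral integrable_const_bound[where B = "real n"])
         (auto simp: E_sum_le E_nonneg intro!: sum_nonneg)
    also have "\<dots> \<le> ennreal (\<bar>a\<bar> / (b - a))"
    proof (rule ennreal_leI)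
      have "(\<integral>\<omega>. (\<Sum>j<n. E j \<omega>) \<partial>M)
          \<le> (\<integral>\<omega>. ((\<Sum>j<n. I j \<omega> * (Y (Suc j) \<omega> - Y j \<omega>)) + \<bar>a\<bar>) / (b - a) \<partial>M)"
        using bound[of n] 
        by (intro integral_mono_AE integrable_const_bound[where B = "real n"] 
            Bochner_Integration.integrable_divide Bochner_Integration.integrable_add
            Bochner_Integration.integrable_sum I_int integrable_const)
         (auto simp: E_sum_le)
      also have "\<dots> = ((\<Sum>j<n. \<integral>\<omega>. I j \<omega> * (Y (Suc j) \<omega> - Y j \<omega>) \<partial>M) + \<bar>a\<bar>) / (b - a)"
        using I_int by (simp add: prob_space)
      also have "\<dots> \<le> \<bar>a\<bar> / (b - a)"
        using assms by (intro divide_right_mono) (auto intro!: sum_nonpos I_le)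
      finally show "(\<integral>\<omega>. (\<Sum>j<n. E j \<omega>) \<partial>M) \<le> \<bar>a\<bar> / (b - a)" .
    qed
    finally show "(\<Sum>j<n. \<integral>\<^sup>+\<omega>. ennreal (E j \<omega>) \<partial>M) \<le> ennreal (\<bar>a\<bar> / (b - a))" .
  qed simp
  finally have "(\<integral>\<^sup>+\<omega>. (\<Sum>n. ennreal (E n \<omega>)) \<partial>M) \<noteq> \<infinity>"
    by (auto simp: top_unique)
  then have "AE \<omega> in M. (\<Sum>n. ennreal (E n \<omega>)) \<noteq> \<infinity>"
    by (intro nn_integral_PInf_AE) simp
  then show ?thesis
  proof eventually_elim
    case (elim \<omega>)
    then have "summable (\<lambda>n. E n \<omega>)"
      by (intro summable_suminf_not_top) (auto simp: E_def)
    then have "(\<lambda>n. E n \<omega>) \<longlonglongrightarrow> 0" by (rule summable_LIMSEQ_zero)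
    then have "\<forall>\<^sub>F n in sequentially. E n \<omega> < 1" by (rule order_tendstoD) simp
    then have "\<forall>\<^sub>F n in sequentially. \<not> ends_upcrossing a b (\<lambda>k. Y k \<omega>) n"
      by eventually_elim (auto simp: E_def)
    then show ?case
      unfolding eventually_sequentially finite_nat_set_iff_bounded
      by (metis mem_Collect_eq not_less)
  qed
qed

text \<open>Doob's convergence theorem. A gap between the lower and the upper limit would contain
  two rational levels crossed infinitely often; Fatou's lemma excludes an infinite limit.\<close>

theorem AE_convergent: "AE \<omega> in M. convergent (\<lambda>k. Y k \<omega>)"
proof -
  have nonneg: "AE \<omega> in M. \<forall>k. 0 \<le> Y k \<omega>"
    by (simp add: AE_all_countable Y_nonneg)
  \<comment> \<open>Rational levels keep the union of the exceptional null sets countable.\<close>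
  have up: "AE \<omega> in M. \<forall>r s :: rat. r < s \<longrightarrow>
      finite {n. ends_upcrossing (real_of_rat r) (real_of_rat s) (\<lambda>k. Y k \<omega>) n}"
    unfolding AE_all_countable using AE_finite_upcrossings by (auto simp: of_rat_less)
  have "(\<integral>\<^sup>+\<omega>. liminf (\<lambda>k. ennreal (Y k \<omega>)) \<partial>M) \<le> liminf (\<lambda>k. \<integral>\<^sup>+\<omega>. ennreal (Y k \<omega>) \<partial>M)"
    by (intro nn_integral_liminf) simp
  also have "\<dots> \<le> ennreal (\<integral>\<omega>. Y 0 \<omega> \<partial>M)"
  proof (intro Liminf_le always_eventually allI)
    fix k
    have "0 \<le> (\<integral>\<omega>. Z j \<omega> \<partial>M)" for j
      by (intro integral_nonneg_AE) (auto simp: Z_nonneg)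
    then have "(\<integral>\<omega>. Y k \<omega> \<partial>M) \<le> (\<integral>\<omega>. Y 0 \<omega> \<partial>M)"
      using sum_integral_Z_le[of k] sum_nonneg[of "{..<k}" "\<lambda>k. \<integral>\<omega>. Z k \<omega> \<partial>M"] by auto
    then show "(\<integral>\<^sup>+\<omega>. ennreal (Y k \<omega>) \<partial>M) \<le> ennreal (\<integral>\<omega>. Y 0 \<omega> \<partial>M)"
      by (subst nn_integral_eq_integral) (auto simp: integrable_Y Y_nonneg ennreal_leI)
  qed simp
  finally have "(\<integral>\<^sup>+\<omega>. liminf (\<lambda>k. ennreal (Y k \<omega>)) \<partial>M) \<noteq> \<infinity>"
    by (auto simp: top_unique)
  then have "AE \<omega> in M. liminf (\<lambda>k. ennreal (Y k \<omega>)) \<noteq> \<infinity>"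
    by (intro nn_integral_PInf_AE) simp
  with nonneg up show ?thesis
  proof eventually_elim
    case (elim \<omega>)
    define y where "y k = ennreal (Y k \<omega>)" for k
    have "limsup y = liminf y"
    proof (rule ccontr)
      assume "limsup y \<noteq> liminf y"
      then have "liminf y < limsup y"
        using Liminf_le_Limsup[of sequentially y] by auto
      then obtain r where r: "liminf y < ennreal (real_of_rat r)" "ennreal (real_of_rat r) < limsup y"
        using ennreal_rat_dense by blast
      obtain s where s: "ennreal (real_of_rat r) < ennreal (real_of_rat s)" "ennreal (real_of_rat s) < limsup y"
        using ennreal_rat_dense[OF r(2)] by blast
      \<comment> \<open>Since \<open>ennreal\<close> sends negative reals to 0, order can be read
        back on the reals only after positivity of the level is known.\<close>
      have r0: "0 < real_of_rat r"
        using r(1) by (metis ennreal_eq_0_iff not_less not_less_zero)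
      have s0: "0 < real_of_rat s" "r < s"
        using s(1) r0 by (auto simp: ennreal_less_iff of_rat_less)
      have "\<exists>\<^sub>F n in sequentially. y n < ennreal (real_of_rat r)"
      proof (rule ccontr)
        assume "\<not> ?thesis"
        then have "\<forall>\<^sub>F n in sequentially. ennreal (real_of_rat r) \<le> y n"
          by (simp add: frequently_def not_less)
        from Liminf_bounded[OF this] r(1) show False by auto
      qed
      then have 1: "\<exists>\<^sub>F n in sequentially. Y n \<omega> < real_of_rat r"
        by (rule frequently_elim1) (use elim(1) in \<open>auto simp: y_def ennreal_less_iff\<close>)
      have "\<exists>\<^sub>F n in sequentially. ennreal (real_of_rat s) < y n"
      proof (rule ccontr)
        assume "\<not> ?thesis"
        then have "\<forall>\<^sub>F n in sequentially. y n \<le> ennreal (real_of_rat s)"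
          by (simp add: frequently_def not_less)
        from Limsup_bounded[OF this] s(2) show False by auto
      qed
      then have 2: "\<exists>\<^sub>F n in sequentially. real_of_rat s < Y n \<omega>"
        by (rule frequently_elim1) (use s0 in \<open>auto simp: y_def ennreal_less_iff\<close>)
      show False
        using not_oscillating_if_finitely_many_upcrossings[OF elim(2)[rule_format, OF s0(2)]] 1 2
        by auto
    qed
    then have "convergent y" by (simp add: convergent_ereal)
    then obtain L where L: "y \<longlonglongrightarrow> L" by (auto simp: convergent_def)
    then have "L = liminf y" by (simp add: lim_imp_Liminf)
    then have "L \<noteq> \<infinity>" using elim(3) by (simp add: y_def[abs_def])
    then obtain l where "L = ennreal l" "l \<ge> 0" by (cases L) auto
    with L have "(\<lambda>k. Y k \<omega>) \<longlonglongrightarrow> l"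
      using elim(1) by (intro tendsto_ennrealD) (auto simp: y_def[abs_def])
    then show ?case by (auto simp: convergent_def)
  qed
qed

text \<open>On the event \<open>A\<close> that \<open>Y k\<close> is below \<open>L\<close>, later
  expectations do not exceed that of \<open>Y k\<close>. In the limit the integral of
  \<open>L\<close> over \<open>A\<close> is at most that of \<open>Y k\<close>, so \<open>A\<close>
  is null. This is where the limit has to be deterministic.\<close>

lemma AE_limit_le:
  assumes lim: "AE \<omega> in M. (\<lambda>k. Y k \<omega>) \<longlonglongrightarrow> L"
  shows "AE \<omega> in M. L \<le> Y k \<omega>"
proof -
  define A where "A = {\<omega>\<in>space (F k). Y k \<omega> < L}"
  have A: "A \<in> sets (F k)"
    unfolding A_def using adapted[of k] by measurable
  note AM [measurable] = sets_F[OF A]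
  \<comment> \<open>Truncation at \<open>L\<close> provides a dominating constant and does not
    change the limit.\<close>
  have "(\<lambda>n. \<integral>\<omega>. indicator A \<omega> * min (Y n \<omega>) L \<partial>M) \<longlonglongrightarrow> (\<integral>\<omega>. indicator A \<omega> * L \<partial>M)"
  proof (rule integral_dominated_convergence[where w = "\<lambda>_. \<bar>L\<bar>"])
    show "AE \<omega> in M. (\<lambda>n. indicator A \<omega> * min (Y n \<omega>) L) \<longlonglongrightarrow> indicator A \<omega> * L"
      using lim
    proof eventually_elim
      case (elim \<omega>)
      from tendsto_min[OF this tendsto_const[of L]] show ?case
        by (intro tendsto_mult) auto
    qed
    show "AE \<omega> in M. norm (indicator A \<omega> * min (Y n \<omega>) L) \<le> \<bar>L\<bar>" for n
      using Y_nonneg[of n] by eventually_elim (auto simp: indicator_def)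
  qed (auto simp: integrable_const)
  moreover have "(\<integral>\<omega>. indicator A \<omega> * min (Y n \<omega>) L \<partial>M) \<le> (\<integral>\<omega>. indicator A \<omega> * Y k \<omega> \<partial>M)"
    if "n \<ge> k" for n
  proof -
    have "(\<integral>\<omega>. indicator A \<omega> * min (Y n \<omega>) L \<partial>M) \<le> (\<integral>\<omega>. indicator A \<omega> * Y n \<omega> \<partial>M)"
      by (intro integral_mono integrable_indicator_mult AM integrable_Y integrable_min integrable_const)
         (auto simp: indicator_def)
    with decrease_iterated[OF A that] show ?thesis by simp
  qed
  ultimately have le: "(\<integral>\<omega>. indicator A \<omega> * L \<partial>M) \<le> (\<integral>\<omega>. indicator A \<omega> * Y k \<omega> \<partial>M)"
    by (intro LIMSEQ_le_const2) auto
  have int: "integrable M (\<lambda>\<omega>. indicator A \<omega> * (L - Y k \<omega>))"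
    by (intro integrable_indicator_mult AM Bochner_Integration.integrable_diff integrable_Y integrable_const)
  have nonneg: "0 \<le> indicator A \<omega> * (L - Y k \<omega>)" for \<omega>
    by (auto simp: A_def indicator_def)
  have "(\<integral>\<omega>. indicator A \<omega> * (L - Y k \<omega>) \<partial>M)
      = (\<integral>\<omega>. indicator A \<omega> * L - indicator A \<omega> * Y k \<omega> \<partial>M)"
    by (simp add: algebra_simps)
  also have "\<dots> \<le> 0"
    using le integrable_indicator_mult[OF AM integrable_Y[of k]] integrable_indicator_mult[OF AM integrable_const[of L]]
    by simp
  finally have "(\<integral>\<omega>. indicator A \<omega> * (L - Y k \<omega>) \<partial>M) = 0"
    by (rule antisym) (intro Bochner_Integration.integral_nonneg nonneg)
  then have "AE \<omega> in M. indicator A \<omega> * (L - Y k \<omega>) = 0"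
    using integral_nonneg_eq_0_iff_AE[OF int] nonneg by simp
  then show ?thesis
    using AE_space by eventually_elim (auto simp: A_def indicator_def split: if_splits)
qed

text \<open>Extends the inequality from indicators to all nonnegative \<open>F k\<close>-measurable
  multipliers by monotone approximation. Extended nonnegative integrals are used because the weights
  may be unbounded near 0, so integrability of the products is not known beforehand.\<close>

lemma nn_decrease:
  assumes "g \<in> borel_measurable (F k)"
  shows "(\<integral>\<^sup>+\<omega>. g \<omega> * ennreal (Y (Suc k) \<omega> + Z k \<omega>) \<partial>M) \<le> (\<integral>\<^sup>+\<omega>. g \<omega> * ennreal (Y k \<omega>) \<partial>M)"
  using assms
proof (induction g rule: borel_measurable_induct)
  case (cong f g)
  have "(\<integral>\<^sup>+\<omega>. f \<omega> * h \<omega> \<partial>M) = (\<integral>\<^sup>+\<omega>. g \<omega> * h \<omega> \<partial>M)" for h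
    using cong(3) by (intro nn_integral_cong) auto
  with cong show ?case by simp
next
  case (set A)
  note [measurable] = sets_F[OF set]
  have eq: "(\<integral>\<^sup>+\<omega>. indicator A \<omega> * ennreal (f \<omega>) \<partial>M) = ennreal (\<integral>\<omega>. indicator A \<omega> * f \<omega> \<partial>M)"
    if "integrable M f" "AE \<omega> in M. 0 \<le> f \<omega>" for f
  proof -
    have "(\<integral>\<^sup>+\<omega>. indicator A \<omega> * ennreal (f \<omega>) \<partial>M) = (\<integral>\<^sup>+\<omega>. ennreal (indicator A \<omega> * f \<omega>) \<partial>M)"
      by (intro nn_integral_cong) (auto simp: indicator_def)
    also have "\<dots> = ennreal (\<integral>\<omega>. indicator A \<omega> * f \<omega> \<partial>M)"
      using that by (intro nn_integral_eq_integral integrable_indicator_mult) (auto simp: indicator_def)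
    finally show ?thesis .
  qed
  have "AE \<omega> in M. 0 \<le> Y (Suc k) \<omega> + Z k \<omega>"
    using Y_nonneg[of "Suc k"] AE_space by eventually_elim (simp add: Z_nonneg)
  then show ?case
    by (subst (1 2) eq) (auto simp: integrable_Y integrable_Z Y_nonneg intro!: ennreal_leI decrease set)
next
  case (mult u c)
  note [measurable] = mult.hyps(2)[THEN measurable_M_of_F]
  show ?case
    using mult.IH by (simp add: mult.assoc nn_integral_cmult mult_left_mono)
next
  case (add u v)
  note [measurable] = add.hyps(1,3)[THEN measurable_M_of_F]
  show ?case
    using add.IH by (simp add: distrib_right nn_integral_add add_mono)
next
  case (seq U)
  note [measurable] = seq.hyps(1)[THEN measurable_M_of_F]
  have mono: "incseq (\<lambda>i \<omega>. U i \<omega> * h \<omega>)" for h :: "'w \<Rightarrow> ennreal"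
    using seq.hyps(3) by (auto simp: incseq_def le_fun_def intro!: mult_right_mono)
  have eq: "(\<integral>\<^sup>+\<omega>. (SUP i. U i) \<omega> * h \<omega> \<partial>M) = (SUP i. \<integral>\<^sup>+\<omega>. U i \<omega> * h \<omega> \<partial>M)"
    if [measurable]: "h \<in> borel_measurable M" for h
    using mono by (subst nn_integral_monotone_convergence_SUP[symmetric]) (auto simp: SUP_mult_right_ennreal image_image)
  show ?case
    using seq.IH by (subst (1 2) eq) (auto intro!: SUP_mono)
qed

text \<open>On the event \<open>Y k = 0\<close> the nonnegative variable
  \<open>Y (Suc k) + Z k\<close> has integral at most 0. This handles the point 0, where a weight
  has no tangent inequality to offer.\<close>

lemma AE_zero_absorbing: "AE \<omega> in M. Y k \<omega> = 0 \<longrightarrow> Y (Suc k) \<omega> = 0 \<and> Z k \<omega> = 0"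
proof -
  define A where "A = {\<omega>\<in>space (F k). Y k \<omega> = 0}"
  have A: "A \<in> sets (F k)"
    unfolding A_def using adapted[of k] by measurable
  note AM [measurable] = sets_F[OF A]
  have "(\<integral>\<^sup>+\<omega>. indicator A \<omega> * ennreal (Y (Suc k) \<omega> + Z k \<omega>) \<partial>M) \<le> (\<integral>\<^sup>+\<omega>. indicator A \<omega> * ennreal (Y k \<omega>) \<partial>M)"
    using A by (intro nn_decrease) simp
  also have "\<dots> = (\<integral>\<^sup>+\<omega>. 0 \<partial>M)"
    by (intro nn_integral_cong) (auto simp: A_def indicator_def)
  finally have "AE \<omega> in M. indicator A \<omega> * ennreal (Y (Suc k) \<omega> + Z k \<omega>) = 0"
    by (subst nn_integral_0_iff_AE[symmetric]) auto
  with Y_nonneg[of "Suc k"] AE_space show ?thesis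
  proof eventually_elim
    case (elim \<omega>)
    have "Z k \<omega> \<ge> 0" using elim by (simp add: Z_nonneg)
    with elim show ?case
      by (auto simp: A_def indicator_def ennreal_eq_0_iff split: if_splits)
  qed
qed

text \<open>The tangent inequality at \<open>Y k\<close> together with the expected decrease of
  \<open>Y\<close> gives \<open>P (Suc k) + Q k \<le> P k\<close>. This telescopes, and the bound on
  \<open>\<phi>\<close> makes \<open>P 0\<close> finite, so the weighted series has finite
  expectation.\<close>

lemma AE_summable_KL_weight:
  assumes KL: "KL_weight w"
  shows "AE \<omega> in M. summable (\<lambda>k. w (Y k \<omega>) * Z k \<omega>)"
proof -
  have [measurable]: "w \<in> borel_measurable borel"
    and w: "w 0 = 0" "\<And>x. 0 \<le> x \<Longrightarrow> 0 \<le> w x"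
    using KL by (auto simp: KL_weight_def)
  obtain \<phi> B where [measurable]: "\<phi> \<in> borel_measurable borel" and \<phi>0: "\<phi> 0 = 0"
    and \<phi>_bounds: "\<forall>y\<ge>0. 0 \<le> \<phi> y \<and> \<phi> y \<le> B"
    and \<phi>_tangent: "\<forall>x>0. \<forall>y\<ge>0. \<phi> y \<le> \<phi> x + w x * (y - x)"
    using KL unfolding KL_weight_def by blast
  have \<phi>: "\<phi> 0 = 0" "\<And>y. 0 \<le> y \<Longrightarrow> 0 \<le> \<phi> y" "\<And>y. 0 \<le> y \<Longrightarrow> \<phi> y \<le> B"
    using \<phi>0 \<phi>_bounds by auto
  have tangent: "\<phi> y \<le> \<phi> x + w x * (y - x)" if "0 < x" "0 \<le> y" for x y
    using \<phi>_tangent that by blast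
  define P where "P k = (\<integral>\<^sup>+\<omega>. ennreal (\<phi> (Y k \<omega>)) \<partial>M)" for k
  define Q where "Q k = (\<integral>\<^sup>+\<omega>. ennreal (w (Y k \<omega>) * Z k \<omega>) \<partial>M)" for k
  have P_fin: "P k \<le> ennreal B" for k
  proof -
    have "AE \<omega> in M. ennreal (\<phi> (Y k \<omega>)) \<le> ennreal B"
      using Y_nonneg[of k] by eventually_elim (intro ennreal_leI \<phi>)
    then have "P k \<le> (\<integral>\<^sup>+\<omega>. ennreal B \<partial>M)"
      unfolding P_def by (rule nn_integral_mono_AE)
    then show ?thesis by (simp add: emeasure_space_1)
  qed
  have step: "P (Suc k) + Q k \<le> P k" for k
  proof -
    \<comment> \<open>\<open>b\<close> and \<open>d\<close> are the integrals of the two parts of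
      the tangent term \<open>w x * (y - x)\<close>. They stay on opposite sides of the
      inequalities, and \<open>b\<close> is cancelled at the end once it is known to be
      finite.\<close>
    define b where "b = (\<integral>\<^sup>+\<omega>. ennreal (w (Y k \<omega>)) * ennreal (Y k \<omega>) \<partial>M)"
    define d where "d = (\<integral>\<^sup>+\<omega>. ennreal (w (Y k \<omega>)) * ennreal (Y (Suc k) \<omega>) \<partial>M)"
    have "b \<le> P k"
      unfolding b_def P_def
    proof (intro nn_integral_mono_AE)
      show "AE \<omega> in M. ennreal (w (Y k \<omega>)) * ennreal (Y k \<omega>) \<le> ennreal (\<phi> (Y k \<omega>))"
        using Y_nonneg[of k]
      proof eventually_elim
        case (elim \<omega>)
        \<comment> \<open>The tangent at \<open>Y k\<close>, evaluated at 0 where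
          \<open>\<phi>\<close> vanishes, bounds \<open>w x * x\<close> by
          \<open>\<phi> x\<close>.\<close>
        then have "w (Y k \<omega>) * Y k \<omega> \<le> \<phi> (Y k \<omega>)"
          using tangent[of "Y k \<omega>" 0] \<phi>(1) w(1) by (cases "Y k \<omega> = 0") auto
        then show ?case
          using elim w(2)[OF elim] by (simp only: ennreal_mult'[symmetric] ennreal_leI)
      qed
    qed
    then have b_fin: "b \<noteq> top" using P_fin[of k] by (auto simp: top_unique)
    have "d + Q k = (\<integral>\<^sup>+\<omega>. ennreal (w (Y k \<omega>)) * ennreal (Y (Suc k) \<omega>) + ennreal (w (Y k \<omega>) * Z k \<omega>) \<partial>M)"
      unfolding d_def Q_def by (intro nn_integral_add[symmetric]) auto
    also have "\<dots> = (\<integral>\<^sup>+\<omega>. ennreal (w (Y k \<omega>)) * ennreal (Y (Suc k) \<omega> + Z k \<omega>) \<partial>M)"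
    proof (rule nn_integral_cong_AE)
      show "AE \<omega> in M. ennreal (w (Y k \<omega>)) * ennreal (Y (Suc k) \<omega>) + ennreal (w (Y k \<omega>) * Z k \<omega>)
          = ennreal (w (Y k \<omega>)) * ennreal (Y (Suc k) \<omega> + Z k \<omega>)"
        using Y_nonneg[of k] Y_nonneg[of "Suc k"] AE_space
        by eventually_elim (simp add: Z_nonneg w(2) ennreal_mult' distrib_left)
    qed
    also have "\<dots> \<le> b"
      unfolding b_def
    proof (rule nn_decrease)
      note [measurable] = adapted[of k]
      show "(\<lambda>\<omega>. ennreal (w (Y k \<omega>))) \<in> borel_measurable (F k)" by measurable
    qed
    finally have 1: "d + Q k \<le> b" .
    have "P (Suc k) + b = (\<integral>\<^sup>+\<omega>. ennreal (\<phi> (Y (Suc k) \<omega>)) + ennreal (w (Y k \<omega>)) * ennreal (Y k \<omega>) \<partial>M)"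
      unfolding P_def b_def by (intro nn_integral_add[symmetric]) auto
    also have "\<dots> \<le> (\<integral>\<^sup>+\<omega>. ennreal (\<phi> (Y k \<omega>)) + ennreal (w (Y k \<omega>)) * ennreal (Y (Suc k) \<omega>) \<partial>M)"
    proof (rule nn_integral_mono_AE)
      show "AE \<omega> in M. ennreal (\<phi> (Y (Suc k) \<omega>)) + ennreal (w (Y k \<omega>)) * ennreal (Y k \<omega>)
          \<le> ennreal (\<phi> (Y k \<omega>)) + ennreal (w (Y k \<omega>)) * ennreal (Y (Suc k) \<omega>)"
        using Y_nonneg[of k] Y_nonneg[of "Suc k"] AE_zero_absorbing[of k]
      proof eventually_elim
        case (elim \<omega>)
        \<comment> \<open>If \<open>Y k\<close> is 0, then \<open>Y (Suc k)\<close> is 0 as well by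
          absorption, and both sides vanish.\<close>
        then have "\<phi> (Y (Suc k) \<omega>) + w (Y k \<omega>) * Y k \<omega> \<le> \<phi> (Y k \<omega>) + w (Y k \<omega>) * Y (Suc k) \<omega>"
          using tangent[of "Y k \<omega>" "Y (Suc k) \<omega>"] w(1) \<phi>(1)
          by (cases "Y k \<omega> = 0") (auto simp: algebra_simps)
        then have "ennreal (\<phi> (Y (Suc k) \<omega>) + w (Y k \<omega>) * Y k \<omega>)
            \<le> ennreal (\<phi> (Y k \<omega>) + w (Y k \<omega>) * Y (Suc k) \<omega>)"
          by (rule ennreal_leI)
        then show ?case
          using elim by (simp add: \<phi>(2) w(2) ennreal_mult')
      qed
    qed
    also have "\<dots> = P k + d"
      unfolding P_def d_def by (intro nn_integral_add) auto
    finally have 2: "P (Suc k) + b \<le> P k + d" .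
    have "b + (P (Suc k) + Q k) = (P (Suc k) + b) + Q k" by (simp add: ac_simps)
    also have "\<dots> \<le> (P k + d) + Q k" by (intro add_right_mono 2)
    also have "\<dots> = P k + (d + Q k)" by (simp add: ac_simps)
    also have "\<dots> \<le> P k + b" by (intro add_left_mono 1)
    finally show ?thesis
      using b_fin by (simp add: add.commute[of _ b] ennreal_add_left_cancel_le)
  qed
  have sum_le: "(\<Sum>k<n. Q k) + P n \<le> P 0" for n
  proof (induction n)
    case (Suc n)
    have "(\<Sum>k<Suc n. Q k) + P (Suc n) = (\<Sum>k<n. Q k) + (P (Suc n) + Q n)" by (simp add: ac_simps)
    also have "\<dots> \<le> (\<Sum>k<n. Q k) + P n" by (intro add_left_mono step)
    finally show ?case using Suc by (rule order_trans)
  qed simp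
  have "(\<integral>\<^sup>+\<omega>. (\<Sum>k. ennreal (w (Y k \<omega>) * Z k \<omega>)) \<partial>M) = (\<Sum>k. Q k)"
    unfolding Q_def by (intro nn_integral_suminf) simp
  also have "\<dots> \<le> P 0"
  proof (rule suminf_le_const)
    show "(\<Sum>k<n. Q k) \<le> P 0" for n
      by (rule order_trans[OF _ sum_le[of n]]) simp
  qed simp
  finally have "(\<integral>\<^sup>+\<omega>. (\<Sum>k. ennreal (w (Y k \<omega>) * Z k \<omega>)) \<partial>M) \<noteq> \<infinity>"
    using P_fin[of 0] by (auto simp: top_unique)
  then have "AE \<omega> in M. (\<Sum>k. ennreal (w (Y k \<omega>) * Z k \<omega>)) \<noteq> \<infinity>"
    by (intro nn_integral_PInf_AE) simp
  moreover have "AE \<omega> in M. \<forall>k. 0 \<le> Y k \<omega>"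
    by (simp add: AE_all_countable Y_nonneg)
  ultimately show ?thesis
    using AE_space by eventually_elim (intro summable_suminf_not_top, auto intro!: mult_nonneg_nonneg Z_nonneg w)
qed

text \<open>Subtracting a constant preserves the decrease; nonnegativity after the shift is
  \<open>AE_limit_le\<close>.\<close>

lemma shift_by_limit:
  assumes lim: "AE \<omega> in M. (\<lambda>k. Y k \<omega>) \<longlonglongrightarrow> L"
  shows "nonneg_supermartingale M F (\<lambda>k \<omega>. Y k \<omega> - L) Z"
proof unfold_locales
  show "AE \<omega> in M. 0 \<le> Y k \<omega> - L" for k
    using AE_limit_le[OF lim, of k] by eventually_elim simp
  show "(\<lambda>\<omega>. Y k \<omega> - L) \<in> borel_measurable (F k)" for k
    using adapted by (intro borel_measurable_diff) auto
  fix k A assume A: "A \<in> sets (F k)"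
  note AM = sets_F[OF A]
  have "(\<integral>\<omega>. indicator A \<omega> * (Y (Suc k) \<omega> - L + Z k \<omega>) \<partial>M)
      = (\<integral>\<omega>. indicator A \<omega> * (Y (Suc k) \<omega> + Z k \<omega>) - indicator A \<omega> * L \<partial>M)"
    by (simp add: algebra_simps)
  also have "\<dots> = (\<integral>\<omega>. indicator A \<omega> * (Y (Suc k) \<omega> + Z k \<omega>) \<partial>M) - (\<integral>\<omega>. indicator A \<omega> * L \<partial>M)"
    by (intro Bochner_Integration.integral_diff integrable_indicator_mult AM
        Bochner_Integration.integrable_add integrable_Y integrable_Z integrable_const)
  also have "\<dots> \<le> (\<integral>\<omega>. indicator A \<omega> * Y k \<omega> \<partial>M) - (\<integral>\<omega>. indicator A \<omega> * L \<partial>M)"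
    using decrease[OF A] by simp
  also have "\<dots> = (\<integral>\<omega>. indicator A \<omega> * Y k \<omega> - indicator A \<omega> * L \<partial>M)"
    by (intro Bochner_Integration.integral_diff[symmetric] integrable_indicator_mult AM integrable_Y integrable_const)
  finally show "(\<integral>\<omega>. indicator A \<omega> * (Y (Suc k) \<omega> - L + Z k \<omega>) \<partial>M)
      \<le> (\<integral>\<omega>. indicator A \<omega> * (Y k \<omega> - L) \<partial>M)"
    by (simp add: algebra_simps)
qed (auto simp: subalg sets_mono integrable_Y integrable_Z Z_nonneg)

end

section \<open>The descent scheme\<close>

lemma tail_sum_split: "summable \<sigma> \<Longrightarrow> tail_sum \<sigma> k = \<sigma> (Suc k) + tail_sum \<sigma> (Suc k)"
  using suminf_split_head[of "\<lambda>j. \<sigma> (j + Suc k)"] unfolding tail_sum_def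
  by (simp add: summable_iff_shift[of \<sigma> "Suc k"] del: add_Suc_right) simp

lemma tail_sum_nonneg:
  assumes "\<And>j. 0 \<le> \<sigma> j" "summable \<sigma>"
  shows "0 \<le> tail_sum \<sigma> k"
  unfolding tail_sum_def using assms
  by (intro suminf_nonneg) (auto simp: summable_iff_shift[of \<sigma> "Suc k"] simp del: add_Suc_right)

lemma tail_sum_tendsto_0:
  assumes "summable \<sigma>"
  shows "tail_sum \<sigma> \<longlonglongrightarrow> 0"
proof -
  have eq: "tail_sum \<sigma> k = suminf \<sigma> - (\<Sum>j<Suc k. \<sigma> j)" for k
    using suminf_minus_initial_segment[OF assms, of "Suc k"] by (simp add: tail_sum_def)
  have "(\<lambda>k. suminf \<sigma> - (\<Sum>j<Suc k. \<sigma> j)) \<longlonglongrightarrow> suminf \<sigma> - suminf \<sigma>"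
    by (intro tendsto_diff tendsto_const LIMSEQ_Suc summable_LIMSEQ assms)
  then show ?thesis by (simp add: eq[abs_def])
qed

lemma integral_indicator_affine:
  fixes f :: "'w \<Rightarrow> real" and g :: "'i \<Rightarrow> 'w \<Rightarrow> real"
  assumes A: "A \<in> sets M" and f: "integrable M f" and g: "\<And>l. l \<in> L \<Longrightarrow> integrable M (g l)"
  shows "(\<integral>\<omega>. indicator A \<omega> * (f \<omega> + (\<Sum>l\<in>L. c l * g l \<omega>)) \<partial>M)
       = (\<integral>\<omega>. indicator A \<omega> * f \<omega> \<partial>M) + (\<Sum>l\<in>L. c l * (\<integral>\<omega>. indicator A \<omega> * g l \<omega> \<partial>M))"
proof -
  have int: "integrable M (\<lambda>\<omega>. indicator A \<omega> * h \<omega>)" if "integrable M h" for h :: "'w \<Rightarrow> real"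
    using integrable_mult_indicator[OF A that] by simp
  have "(\<integral>\<omega>. indicator A \<omega> * (f \<omega> + (\<Sum>l\<in>L. c l * g l \<omega>)) \<partial>M)
      = (\<integral>\<omega>. indicator A \<omega> * f \<omega> + (\<Sum>l\<in>L. c l * (indicator A \<omega> * g l \<omega>)) \<partial>M)"
    by (simp add: distrib_left sum_distrib_left mult.left_commute)
  also have "\<dots> = (\<integral>\<omega>. indicator A \<omega> * f \<omega> \<partial>M) + (\<integral>\<omega>. (\<Sum>l\<in>L. c l * (indicator A \<omega> * g l \<omega>)) \<partial>M)"
    using f g by (intro Bochner_Integration.integral_add int Bochner_Integration.integrable_sum integrable_mult_right) auto
  also have "(\<integral>\<omega>. (\<Sum>l\<in>L. c l * (indicator A \<omega> * g l \<omega>)) \<partial>M)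
      = (\<Sum>l\<in>L. c l * (\<integral>\<omega>. indicator A \<omega> * g l \<omega> \<partial>M))"
    using g by (subst Bochner_Integration.integral_sum) (auto intro!: integrable_mult_right int)
  finally show ?thesis .
qed

text \<open>Of the descent coefficient \<open>a1\<close>, the part \<open>b1\<close> is stored in
  the Lyapunov function and \<open>\<eta>\<close> is released as decrease. One step later the stored
  \<open>b1\<close> pays for \<open>a2\<close>, for the lagged coefficient \<open>b2\<close> and for
  another \<open>\<eta>\<close>; after that \<open>b2\<close> pays for \<open>a3\<close> and a last
  \<open>\<eta>\<close>. The tail of \<open>\<sigma>\<close> absorbs the perturbation. Indices start
  at \<open>k0 + 2\<close> so that both the current and the lagged squares are integrable.\<close>

lemma lyapunov_supermartingale:
  fixes M :: "'w measure" and p :: "nat \<Rightarrow> 'w \<Rightarrow> real" and lam :: "nat \<Rightarrow> nat \<Rightarrow> 'w \<Rightarrow> real"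
    and a1 a2 a3 b1 b2 :: "nat \<Rightarrow> real"
  assumes prob: "prob_space M"
    and subalg: "\<And>k. subalgebra M (F k)"
    and mono: "\<And>i j. i \<le> j \<Longrightarrow> sets (F i) \<subseteq> sets (F j)"
    and p_adapted: "\<And>k. p k \<in> borel_measurable (F k)"
    and p_low: "\<And>k. AE \<omega> in M. low \<le> p k \<omega>"
    and lam_adapted: "\<And>l k. l \<in> {1..m} \<Longrightarrow> lam l k \<in> borel_measurable (F k)"
    and sigma: "\<And>k. 0 \<le> \<sigma> k" "summable \<sigma>"
    and integrable_p: "\<And>k. k0 \<le> k \<Longrightarrow> integrable M (p (Suc k))"
    and integrable_lam: "\<And>l k. l \<in> {1..m} \<Longrightarrow> k0 \<le> k \<Longrightarrow> integrable M (\<lambda>\<omega>. (lam l (Suc k) \<omega>)\<^sup>2)"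
    and \<eta>: "0 < \<eta>"
    and b: "\<And>l. l \<in> {1..m} \<Longrightarrow> b1 l = a1 l - \<eta>" "\<And>l. l \<in> {1..m} \<Longrightarrow> b2 l = max (a3 l) 0 + \<eta>"
        "\<And>l. l \<in> {1..m} \<Longrightarrow> 0 \<le> b1 l" "\<And>l. l \<in> {1..m} \<Longrightarrow> a2 l + b2 l + \<eta> \<le> b1 l"
    and descent: "\<And>k. k0 \<le> k \<Longrightarrow> AE \<omega> in M. real_cond_exp M (F k) (p (Suc k)) \<omega>
             \<le> p k \<omega> - (\<Sum>l=1..m. a1 l * real_cond_exp M (F k) (\<lambda>\<omega>. (lam l (Suc k) \<omega>)\<^sup>2) \<omega>)
                + (\<Sum>l=1..m. a2 l * (lam l k \<omega>)\<^sup>2)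
                + (\<Sum>l=1..m. a3 l * (lag (lam l) k \<omega>)\<^sup>2)
                + \<sigma> (Suc k)"
  shows "nonneg_supermartingale M (\<lambda>n. F (n + Suc (Suc k0)))
    (\<lambda>n \<omega>. p (n + Suc (Suc k0)) \<omega>
        + (\<Sum>l=1..m. b1 l * (lam l (n + Suc (Suc k0)) \<omega>)\<^sup>2 + b2 l * (lag (lam l) (n + Suc (Suc k0)) \<omega>)\<^sup>2)
        + tail_sum \<sigma> (n + Suc (Suc k0)) - low)
    (\<lambda>n \<omega>. \<eta> * (\<Sum>l=1..m. (lam l (Suc (n + Suc (Suc k0))) \<omega>)\<^sup>2 + (lam l (n + Suc (Suc k0)) \<omega>)\<^sup>2
        + (lag (lam l) (n + Suc (Suc k0)) \<omega>)\<^sup>2))"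
proof -
  interpret prob_space M by fact
  \<comment> \<open>At these indices the lag is a genuine predecessor, never the default value
    0.\<close>
  have lag: "lag (lam l) (n + Suc (Suc k0)) = lam l (Suc (n + k0))" for l n
    by (simp add: lag_def fun_eq_iff)
  have b2: "0 \<le> b2 l" if "l \<in> {1..m}" for l using b(2)[OF that] \<eta> by auto
  have int_lam: "integrable M (\<lambda>\<omega>. (lam l k \<omega>)\<^sup>2)" if "l \<in> {1..m}" "k > k0" for l k
    using integrable_lam[OF that(1), of "k - 1"] that(2) by (cases k) auto
  have int_p: "integrable M (p k)" if "k > k0" for k
    using integrable_p[of "k - 1"] that by (cases k) auto
  have ad: "f \<in> borel_measurable (F j)" if "i \<le> j" "f \<in> borel_measurable (F i)" for i j and f :: "'w \<Rightarrow> real"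
    using measurable_from_subalg[of "F j" "F i" f borel] mono[OF that(1)] subalg[of i] subalg[of j] that(2)
    by (simp add: subalgebra_def)
  show ?thesis
    unfolding lag
  proof (unfold_locales, goal_cases)
    case (3 n)
    have [measurable]: "lam l (Suc (n + k0)) \<in> borel_measurable (F (n + Suc (Suc k0)))"
        "lam l (n + Suc (Suc k0)) \<in> borel_measurable (F (n + Suc (Suc k0)))" if "l \<in> {1..m}" for l
      using lam_adapted[OF that] by (auto intro: ad[of "Suc (n + k0)"])
    have [measurable]: "p (n + Suc (Suc k0)) \<in> borel_measurable (F (n + Suc (Suc k0)))"
      by (rule p_adapted)
    show ?case by measurable
  next
    case (4 n)
    show ?case
      by (intro Bochner_Integration.integrable_add Bochner_Integration.integrable_diff
          Bochner_Integration.integrable_sum integrable_mult_right int_lam int_p integrable_const) auto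
  next
    case (5 n)
    show ?case
      by (intro Bochner_Integration.integrable_add 
          Bochner_Integration.integrable_sum integrable_mult_right int_lam) auto
  next
    case (6 n)
    show ?case
      using p_low[of "n + Suc (Suc k0)"]
    proof eventually_elim
      case (elim \<omega>)
      have "0 \<le> (\<Sum>l=1..m. b1 l * (lam l (n + Suc (Suc k0)) \<omega>)\<^sup>2 + b2 l * (lam l (Suc (n + k0)) \<omega>)\<^sup>2)"
        using b(3) b2 by (intro sum_nonneg add_nonneg_nonneg mult_nonneg_nonneg) auto
      then show ?case using elim tail_sum_nonneg[OF sigma, of "n + Suc (Suc k0)"] by linarith
    qed
  next
    case (7 n \<omega>)
    show ?case using \<eta> by (intro mult_nonneg_nonneg sum_nonneg add_nonneg_nonneg) auto
  next
    case (8 n A)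
    define k where "k = n + Suc (Suc k0)"
    define j where "j = Suc (n + k0)"
    have k: "k0 < k" "k0 < j" "k = Suc j" by (auto simp: k_def j_def)
    have A: "A \<in> sets (F k)" using 8 by (simp add: k_def)
    have AM: "A \<in> sets M" using A subalg[of k] by (auto simp: subalgebra_def)
    interpret finite_measure_subalgebra M "F k" using subalg[of k] by unfold_locales
    have int: "integrable M (\<lambda>\<omega>. indicator A \<omega> * h \<omega>)" if "integrable M h" for h :: "'w \<Rightarrow> real"
      using integrable_mult_indicator[OF AM that] by simp
    have cond: "(\<integral>\<omega>. indicator A \<omega> * real_cond_exp M (F k) f \<omega> \<partial>M) = (\<integral>\<omega>. indicator A \<omega> * f \<omega> \<partial>M)"
      if "integrable M f" for f
      using real_cond_exp_intA[OF that A] by (simp add: set_lebesgue_integral_def)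
    \<comment> \<open>The next Lyapunov value plus the decrease is \<open>G + T\<close>, with the
      terms of time \<open>k + 1\<close> in \<open>G\<close> and those known at time
      \<open>k\<close> in \<open>T\<close>. \<open>G'\<close> is the conditional expectation of
      \<open>G\<close> taken term by term, \<open>R\<close> its bound by the descent inequality, and
      \<open>V\<close> the present Lyapunov value. It remains to see
      \<open>R + T \<le> V\<close>.\<close>
    define G where "G \<omega> = p (Suc k) \<omega> + (\<Sum>l=1..m. a1 l * (lam l (Suc k) \<omega>)\<^sup>2)" for \<omega>
    define G' where "G' \<omega> = real_cond_exp M (F k) (p (Suc k)) \<omega>
        + (\<Sum>l=1..m. a1 l * real_cond_exp M (F k) (\<lambda>\<omega>. (lam l (Suc k) \<omega>)\<^sup>2) \<omega>)" for \<omega>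
    define R where "R \<omega> = p k \<omega> + (\<Sum>l=1..m. a2 l * (lam l k \<omega>)\<^sup>2)
                + (\<Sum>l=1..m. a3 l * (lam l j \<omega>)\<^sup>2) + \<sigma> (Suc k)" for \<omega>
    define T where "T \<omega> = (\<Sum>l=1..m. (b2 l + \<eta>) * (lam l k \<omega>)\<^sup>2 + \<eta> * (lam l j \<omega>)\<^sup>2)
        + tail_sum \<sigma> (Suc k) - low" for \<omega>
    define V where "V \<omega> = p k \<omega> + (\<Sum>l=1..m. b1 l * (lam l k \<omega>)\<^sup>2 + b2 l * (lam l j \<omega>)\<^sup>2)
        + tail_sum \<sigma> k - low" for \<omega>
    have int_G: "integrable M G" and int_G': "integrable M G'" and int_R: "integrable M R"
      and int_T: "integrable M T" and int_V: "integrable M V"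
      unfolding G_def G'_def R_def T_def V_def using k
      by (intro Bochner_Integration.integrable_add Bochner_Integration.integrable_diff
          Bochner_Integration.integrable_sum integrable_mult_right int_lam int_p integrable_const
          real_cond_exp_int(1); simp)+
    have "(\<integral>\<omega>. indicator A \<omega> * G \<omega> \<partial>M) = (\<integral>\<omega>. indicator A \<omega> * G' \<omega> \<partial>M)"
      unfolding G_def G'_def using k(1)
      by (subst (1 2) integral_indicator_affine)
         (auto simp: AM cond int_p int_lam intro!: real_cond_exp_int(1) sum.cong)
    also have "\<dots> \<le> (\<integral>\<omega>. indicator A \<omega> * R \<omega> \<partial>M)"
    proof (intro integral_mono_AE int int_G' int_R)
      have "AE \<omega> in M. G' \<omega> \<le> R \<omega>"
        using descent[of k] k(1)
        by (auto simp: G'_def R_def k(3) lag_def[of _ "Suc _"] elim: AE_mp)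
      then show "AE \<omega> in M. indicator A \<omega> * G' \<omega> \<le> indicator A \<omega> * R \<omega>"
        by eventually_elim (auto simp: indicator_def)
    qed
    finally have GR: "(\<integral>\<omega>. indicator A \<omega> * G \<omega> \<partial>M) \<le> (\<integral>\<omega>. indicator A \<omega> * R \<omega> \<partial>M)" .
    have RT: "R \<omega> + T \<omega> \<le> V \<omega>" for \<omega>
    proof -
      have "(\<Sum>l=1..m. a2 l * (lam l k \<omega>)\<^sup>2) + (\<Sum>l=1..m. a3 l * (lam l j \<omega>)\<^sup>2)
          + (\<Sum>l=1..m. (b2 l + \<eta>) * (lam l k \<omega>)\<^sup>2 + \<eta> * (lam l j \<omega>)\<^sup>2)
          = (\<Sum>l=1..m. (a2 l + b2 l + \<eta>) * (lam l k \<omega>)\<^sup>2 + (a3 l + \<eta>) * (lam l j \<omega>)\<^sup>2)"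
        unfolding sum.distrib[symmetric] by (intro sum.cong) (auto simp: algebra_simps)
      \<comment> \<open>Coefficientwise, \<open>a2 + b2 + \<eta> \<le> b1\<close> and
        \<open>a3 + \<eta> \<le> b2\<close>.\<close>
      also have "\<dots> \<le> (\<Sum>l=1..m. b1 l * (lam l k \<omega>)\<^sup>2 + b2 l * (lam l j \<omega>)\<^sup>2)"
        using b(2,4) by (intro sum_mono add_mono mult_right_mono) auto
      finally show ?thesis
        using tail_sum_split[OF sigma(2), of k] unfolding R_def T_def V_def by linarith
    qed
    have "(\<integral>\<omega>. indicator A \<omega> * (p (Suc k) \<omega>
        + (\<Sum>l=1..m. b1 l * (lam l (Suc k) \<omega>)\<^sup>2 + b2 l * (lam l (Suc j) \<omega>)\<^sup>2)
        + tail_sum \<sigma> (Suc k) - low +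
        \<eta> * (\<Sum>l=1..m. (lam l (Suc k) \<omega>)\<^sup>2 + (lam l k \<omega>)\<^sup>2 + (lam l j \<omega>)\<^sup>2)) \<partial>M)
      = (\<integral>\<omega>. indicator A \<omega> * (G \<omega> + T \<omega>) \<partial>M)"
    proof (intro Bochner_Integration.integral_cong refl arg_cong2[where f = "(*)"])
      fix \<omega>
      have "(\<Sum>l=1..m. b1 l * (lam l (Suc k) \<omega>)\<^sup>2 + b2 l * (lam l (Suc j) \<omega>)\<^sup>2)
          + \<eta> * (\<Sum>l=1..m. (lam l (Suc k) \<omega>)\<^sup>2 + (lam l k \<omega>)\<^sup>2 + (lam l j \<omega>)\<^sup>2)
          = (\<Sum>l=1..m. a1 l * (lam l (Suc k) \<omega>)\<^sup>2)
          + (\<Sum>l=1..m. (b2 l + \<eta>) * (lam l k \<omega>)\<^sup>2 + \<eta> * (lam l j \<omega>)\<^sup>2)"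
        unfolding sum_distrib_left sum.distrib[symmetric]
        by (intro sum.cong) (auto simp: b(1) k(3) algebra_simps)
      then show "p (Suc k) \<omega>
        + (\<Sum>l=1..m. b1 l * (lam l (Suc k) \<omega>)\<^sup>2 + b2 l * (lam l (Suc j) \<omega>)\<^sup>2)
        + tail_sum \<sigma> (Suc k) - low +
        \<eta> * (\<Sum>l=1..m. (lam l (Suc k) \<omega>)\<^sup>2 + (lam l k \<omega>)\<^sup>2 + (lam l j \<omega>)\<^sup>2) = G \<omega> + T \<omega>"
        unfolding G_def T_def by linarith
    qed
    also have "\<dots> = (\<integral>\<omega>. indicator A \<omega> * G \<omega> \<partial>M) + (\<integral>\<omega>. indicator A \<omega> * T \<omega> \<partial>M)"
      unfolding distrib_left by (intro Bochner_Integration.integral_add int int_G int_T)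
    also have "\<dots> \<le> (\<integral>\<omega>. indicator A \<omega> * R \<omega> \<partial>M) + (\<integral>\<omega>. indicator A \<omega> * T \<omega> \<partial>M)"
      using GR by simp
    also have "\<dots> = (\<integral>\<omega>. indicator A \<omega> * (R \<omega> + T \<omega>) \<partial>M)"
      unfolding distrib_left by (intro Bochner_Integration.integral_add[symmetric] int int_R int_T)
    also have "\<dots> \<le> (\<integral>\<omega>. indicator A \<omega> * V \<omega> \<partial>M)"
      by (intro integral_mono int Bochner_Integration.integrable_add int_R int_T int_V mult_left_mono RT) auto
    finally show ?case
      unfolding V_def by (simp add: k_def j_def)
  qed (auto simp: subalg intro!: mono)
qed

section \<open>Bounds relating the step sum to the individual steps\<close>

lemma lag_nonneg: "(\<And>k. 0 \<le> s k \<omega>) \<Longrightarrow> 0 \<le> lag s k \<omega>"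
  by (cases k) (auto simp: lag_def)

lemma step_sum_nonneg:
  assumes "\<And>l k. l \<in> {1..m} \<Longrightarrow> 0 \<le> lam l k \<omega>"
  shows "0 \<le> step_sum m lam k \<omega>"
  unfolding step_sum_def using assms
  by (intro sum_nonneg add_nonneg_nonneg lag_nonneg) auto

lemma le_step_sum:
  assumes nonneg: "\<And>l k. l \<in> {1..m} \<Longrightarrow> 0 \<le> lam l k \<omega>" and l: "l \<in> {1..m}"
  shows "lam l (Suc k) \<omega> \<le> step_sum m lam k \<omega>" "lam l k \<omega> \<le> step_sum m lam k \<omega>"
    "lag (lam l) k \<omega> \<le> step_sum m lam k \<omega>"
proof -
  have *: "0 \<le> lam i (Suc k) \<omega> + lam i k \<omega> + lag (lam i) k \<omega>" if "i \<in> {1..m}" for i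
    using that by (intro add_nonneg_nonneg lag_nonneg nonneg)
  have "lam l (Suc k) \<omega> + lam l k \<omega> + lag (lam l) k \<omega> \<le> step_sum m lam k \<omega>"
    unfolding step_sum_def using l * by (intro member_le_sum) auto
  moreover have "0 \<le> lam l (Suc k) \<omega>" "0 \<le> lam l k \<omega>" "0 \<le> lag (lam l) k \<omega>"
    using nonneg[OF l] lag_nonneg[of "lam l" \<omega>] by auto
  ultimately show "lam l (Suc k) \<omega> \<le> step_sum m lam k \<omega>" "lam l k \<omega> \<le> step_sum m lam k \<omega>"
    "lag (lam l) k \<omega> \<le> step_sum m lam k \<omega>" by linarith+
qed

text \<open>Cauchy-Schwarz over the \<open>m\<close> indices and then over the three time shifts,
  whence the factor \<open>3 * m\<close>. The right side is a multiple of the summable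
  decrease.\<close>

lemma step_sum_square_le:
  "(step_sum m lam k \<omega>)\<^sup>2 \<le> 3 * real m *
     (\<Sum>l=1..m. (lam l (Suc k) \<omega>)\<^sup>2 + (lam l k \<omega>)\<^sup>2 + (lag (lam l) k \<omega>)\<^sup>2)"
proof -
  have three: "(x + y + z)\<^sup>2 \<le> 3 * (x\<^sup>2 + y\<^sup>2 + z\<^sup>2)" for x y z :: real
  proof -
    have "0 \<le> (x - y)\<^sup>2 + (y - z)\<^sup>2 + (x - z)\<^sup>2" by simp
    then show ?thesis by (simp add: power2_eq_square algebra_simps)
  qed
  have "(step_sum m lam k \<omega>)\<^sup>2 \<le> (\<Sum>l=1..m. (lam l (Suc k) \<omega> + lam l k \<omega> + lag (lam l) k \<omega>)\<^sup>2) * real (card {1..m})"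
    unfolding step_sum_def by (rule sum_squared_le_sum_of_squares)
  also have "\<dots> \<le> (\<Sum>l=1..m. 3 * ((lam l (Suc k) \<omega>)\<^sup>2 + (lam l k \<omega>)\<^sup>2 + (lag (lam l) k \<omega>)\<^sup>2)) * real (card {1..m})"
    by (intro mult_right_mono sum_mono three) simp
  also have "\<dots> = 3 * real m * (\<Sum>l=1..m. (lam l (Suc k) \<omega>)\<^sup>2 + (lam l k \<omega>)\<^sup>2 + (lag (lam l) k \<omega>)\<^sup>2)"
    unfolding sum_distrib_left[symmetric] by simp
  finally show ?thesis .
qed

text \<open>If \<open>D\<close> exceeds \<open>s\<close>, the hypothesis yields
  \<open>1 \<le> 2 * C * w * D\<close>, and multiplying by \<open>D\<close> turns this lower bound
  on the weight into an upper bound on \<open>D\<close> by the weighted square.\<close>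

lemma weighted_square_bound:
  fixes D s w C :: real
  assumes "1 \<le> w * C * (D + s)" "0 \<le> D" "0 \<le> s" "0 \<le> w" "0 \<le> C"
  shows "D \<le> s + 2 * C * (w * D\<^sup>2)"
proof (cases "D \<le> s")
  case True
  moreover have "0 \<le> 2 * C * (w * D\<^sup>2)" using assms by simp
  ultimately show ?thesis by linarith
next
  case False
  have "1 \<le> w * C * (D + s)" by fact
  also have "\<dots> \<le> w * C * (2 * D)" using False assms by (intro mult_left_mono) auto
  finally have "1 * D \<le> w * C * (2 * D) * D" using assms by (intro mult_right_mono) auto
  also have "\<dots> = 2 * C * (w * D\<^sup>2)" by (simp add: power2_eq_square)
  finally show ?thesis using assms by simp
qed

text \<open>The gap \<open>t\<close> of the Lyapunov function is the sum of a function gap \<open>a\<close>, a quadratic part \<open>u\<close>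
  and a tail \<open>v\<close>, and at least one of them exceeds \<open>t / 3\<close>; each case has its own weight.\<close>

lemma KL_gap_split:
  fixes D S q t a u v B E :: real and \<delta> :: ereal
  assumes t: "0 < t" "t < 1" "t = a + u + v" and q: "0 < q" "q < 1"
    and D: "0 \<le> D" "0 \<le> v" and u: "u \<le> B * D\<^sup>2" and B: "0 \<le> B" and E: "0 \<le> E"
    and \<delta>: "\<delta> \<le> ereal (E * (D + v powr q))"
    and KL: "0 < a \<Longrightarrow> a \<le> t \<Longrightarrow> t \<le> 3 * a \<Longrightarrow> \<exists>w\<in>W. 1 \<le> ereal (w t) * \<delta>"
    and u0: "0 \<le> u"
    and W: "\<And>w. w \<in> W \<Longrightarrow> 0 \<le> w t"
  shows "\<exists>w \<in> W \<union> {\<lambda>t. if t \<in> {0<..<1} then t powr (- (1/2)) else 0,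
                    \<lambda>t. if t \<in> {0<..<1} then t powr (- q) else 0}.
           1 \<le> w t * (E + sqrt (3 * B) + 3) * (D + v powr q)"
proof -
  \<comment> \<open>The three cases produce the constants \<open>E\<close>,
    \<open>sqrt (3 * B)\<close> and 3; their sum serves all of them.\<close>
  have gen: "1 \<le> w * (E + sqrt (3 * B) + 3) * (D + v powr q)"
    if "1 \<le> w * (c * (D + v powr q))" "0 \<le> w" "c \<le> E + sqrt (3 * B) + 3" for w c
  proof -
    have "1 \<le> w * (c * (D + v powr q))" by fact
    also have "\<dots> \<le> w * ((E + sqrt (3 * B) + 3) * (D + v powr q))"
      using that D by (intro mult_left_mono mult_right_mono) auto
    finally show ?thesis by (simp add: mult.assoc)
  qed
  consider "t \<le> 3 * a" | "t \<le> 3 * u" | "t \<le> 3 * v" using t by linarith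
  then show ?thesis
  proof cases
    case 1
    \<comment> \<open>The function gap dominates: \<open>t\<close> is at most three times
      \<open>a\<close>, the range in which the KL inequality may be used with the weight at
      \<open>t\<close>.\<close>
    then have "0 < a" "a \<le> t" using t u0 D by linarith+
    then obtain w where w: "w \<in> W" "1 \<le> ereal (w t) * \<delta>" using KL 1 by blast
    note w(2)
    also have "ereal (w t) * \<delta> \<le> ereal (w t) * ereal (E * (D + v powr q))"
      using W[OF w(1)] \<delta> by (intro ereal_mult_left_mono) auto
    finally have "1 \<le> w t * (E * (D + v powr q))" by (simp add: one_ereal_def)
    then show ?thesis
      using gen[of "w t" E] W[OF w(1)] w(1) B by (intro bexI[of _ w]) auto
  next
    case 2
    \<comment> \<open>The quadratic part dominates: \<open>t \<le> 3 * B * D\<^sup>2\<close>, so the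
      weight with exponent 1/2 fits.\<close>
    have "t powr (1/2) \<le> sqrt (3 * B) * D"
    proof -
      have "t \<le> 3 * B * D\<^sup>2" using 2 u by linarith
      then have "sqrt t \<le> sqrt (3 * B * D\<^sup>2)" by simp
      then show ?thesis using t D by (simp add: powr_half_sqrt real_sqrt_mult)
    qed
    then have "t powr (- (1/2)) * t powr (1/2) \<le> t powr (- (1/2)) * (sqrt (3 * B) * D)"
      by (intro mult_left_mono) auto
    then have "1 \<le> t powr (- (1/2)) * (sqrt (3 * B) * D)"
      using t by (simp add: powr_add[symmetric] del: powr_half_sqrt)
    also have "\<dots> \<le> t powr (- (1/2)) * (sqrt (3 * B) * (D + v powr q))"
      using B by (intro mult_left_mono) auto
    finally have "1 \<le> t powr (- (1/2)) * (sqrt (3 * B) * (D + v powr q))" .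
    from gen[OF this] show ?thesis using t E by auto
  next
    case 3
    \<comment> \<open>The tail part dominates: \<open>t powr q\<close> is at most
      \<open>3 * v powr q\<close>, so the weight with exponent \<open>q\<close> matches the term
      \<open>v powr q\<close> of the relative error.\<close>
    have "t powr q \<le> (3 * v) powr q" using 3 t q by (intro powr_mono2) auto
    also have "\<dots> = 3 powr q * v powr q" using D by (simp add: powr_mult)
    also have "\<dots> \<le> 3 * v powr q"
      using q powr_mono[of q 1 3] by (intro mult_right_mono) auto
    finally have "t powr (- q) * t powr q \<le> t powr (- q) * (3 * v powr q)"
      by (intro mult_left_mono) auto
    then have "1 \<le> t powr (- q) * (3 * v powr q)"
      using t by (simp add: powr_add[symmetric])
    also have "\<dots> \<le> t powr (- q) * (3 * (D + v powr q))"
      using D by (intro mult_left_mono) auto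
    finally have "1 \<le> t powr (- q) * (3 * (D + v powr q))" .
    from gen[OF this] show ?thesis using t E B by auto
  qed
qed

text \<open>Otherwise a subsequence stays in the compact set \<open>K - U\<close> and has a cluster
  point outside \<open>U\<close>.\<close>

lemma eventually_in_open_of_cluster_points:
  fixes x :: "nat \<Rightarrow> 'a::metric_space"
  assumes K: "compact K" "\<And>n. x n \<in> K" and U: "open U"
    and cluster: "\<And>r a. strict_mono r \<Longrightarrow> (\<lambda>n. x (r n)) \<longlonglongrightarrow> a \<Longrightarrow> a \<in> K \<Longrightarrow> a \<in> U"
  shows "\<forall>\<^sub>F n in sequentially. x n \<in> U"
proof (rule ccontr)
  assume "\<not> ?thesis"
  from not_eventually_sequentiallyD[OF this]
  obtain r :: "nat \<Rightarrow> nat" where r: "strict_mono r" "\<And>n. x (r n) \<notin> U" by auto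
  have "compact (K - U)" using K(1) U by (rule compact_diff)
  moreover have "\<forall>n. (x \<circ> r) n \<in> K - U" using r(2) K(2) by auto
  ultimately obtain a s where a: "a \<in> K - U" "strict_mono s" "((x \<circ> r) \<circ> s) \<longlonglongrightarrow> a"
    by (meson compact_imp_seq_compact seq_compactE)
  have "a \<in> U"
    using cluster[OF strict_mono_o[OF r(1) a(2)], of a] a(1,3) by (simp add: o_def)
  with a(1) show False by simp
qed

lemma finite_positive_lower_bound:
  fixes f :: "'i \<Rightarrow> real"
  assumes "finite L" "\<And>l. l \<in> L \<Longrightarrow> 0 < f l"
  obtains \<eta> where "0 < \<eta>" "\<And>l. l \<in> L \<Longrightarrow> \<eta> \<le> f l"
proof
  \<comment> \<open>The inserted 1 covers an empty index set.\<close>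
  show "0 < Min (insert 1 (f ` L))" using assms by simp
  show "Min (insert 1 (f ` L)) \<le> f l" if "l \<in> L" for l
    using assms that by simp
qed

theorem theorem4p2:
  fixes M :: "'w measure"
    and F :: "nat \<Rightarrow> 'w measure"
    and \<Psi> :: "real ^ 'd \<Rightarrow> ereal"
    and X :: "nat \<Rightarrow> 'w \<Rightarrow> real ^ 'd"
    and \<Psi>low :: real
    and m k0 :: nat
    and lam :: "nat \<Rightarrow> nat \<Rightarrow> 'w \<Rightarrow> real"
    and \<sigma> :: "nat \<Rightarrow> real"
    and q :: real
  assumes prob: "prob_space M"
    and filt: "filtration (space M) F" "\<And>k. subalgebra M (F k)"
    and Psi: "proper_fun \<Psi>" "lower_semicont \<Psi>"
    and X_dom: "\<And>k \<omega>. \<omega> \<in> space M \<Longrightarrow> X k \<omega> \<in> edom \<Psi>"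
    and X_adapted: "\<And>k. X k \<in> borel_measurable (F k)"
    and X_low: "\<And>k. AE \<omega> in M. ereal \<Psi>low \<le> \<Psi> (X k \<omega>)"
    and lam_nonneg: "\<And>l k \<omega>. l \<in> {1..m} \<Longrightarrow> \<omega> \<in> space M \<Longrightarrow> 0 \<le> lam l k \<omega>"
    and lam_adapted: "\<And>l k. l \<in> {1..m} \<Longrightarrow> lam l k \<in> borel_measurable (F k)"
    and sigma: "\<And>k. 0 \<le> \<sigma> k" "summable \<sigma>"
    and q: "0 < q" "q < 1" "summable (\<lambda>k. tail_sum \<sigma> k powr q)"
    and integrable_Psi: "\<And>k. k0 \<le> k \<Longrightarrow> integrable M (\<lambda>\<omega>. real_of_ereal (\<Psi> (X (Suc k) \<omega>)))"
    and integrable_lam: "\<And>l k. l \<in> {1..m} \<Longrightarrow> k0 \<le> k \<Longrightarrow>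
          integrable M (\<lambda>\<omega>. (lam l (Suc k) \<omega>)\<^sup>2)"
    and descent: "\<exists>a1 a2 a3 :: nat \<Rightarrow> real.
          (\<forall>l\<in>{1..m}. 0 < a1 l \<and> a2 l + max (a3 l) 0 < a1 l) \<and>
          (\<forall>k\<ge>k0. AE \<omega> in M.
             real_cond_exp M (F k) (\<lambda>\<omega>. real_of_ereal (\<Psi> (X (Suc k) \<omega>))) \<omega>
             \<le> real_of_ereal (\<Psi> (X k \<omega>))
                - (\<Sum>l=1..m. a1 l * real_cond_exp M (F k) (\<lambda>\<omega>. (lam l (Suc k) \<omega>)\<^sup>2) \<omega>)
                + (\<Sum>l=1..m. a2 l * (lam l k \<omega>)\<^sup>2)
                + (\<Sum>l=1..m. a3 l * (lag (lam l) k \<omega>)\<^sup>2)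
                + \<sigma> (Suc k))"
    and relative_error: "\<exists>Cre>0. AE \<omega> in M. \<forall>\<^sub>F k in sequentially.
          dist_zero (limiting_subdiff \<Psi> (X k \<omega>))
          \<le> ereal (Cre * (step_sum m lam k \<omega> + tail_sum \<sigma> k powr q))"
    and continuity: "continuous_on (edom \<Psi>) \<Psi>"
  shows "\<exists>\<Psi>inf :: 'w \<Rightarrow> real.
    \<Psi>inf \<in> borel_measurable M \<and>
    (AE \<omega> in M. (\<lambda>k. \<Psi> (X k \<omega>)) \<longlonglongrightarrow> ereal (\<Psi>inf \<omega>)) \<and>
    tail_sum \<sigma> \<longlonglongrightarrow> 0 \<and>
    (\<forall>l\<in>{1..m}. AE \<omega> in M. (\<lambda>k. lam l k \<omega>) \<longlonglongrightarrow> 0) \<and>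
    (AE \<omega> in M. \<forall>x r. strict_mono r \<and> (\<lambda>n. X (r n) \<omega>) \<longlonglongrightarrow> x \<longrightarrow> x \<in> crit \<Psi>) \<and>
    (\<forall>(\<Psi>star :: real) (SPsi :: (real ^ 'd) set).
       (AE \<omega> in M. \<Psi>inf \<omega> = \<Psi>star) \<and>
       compact SPsi \<and> (AE \<omega> in M. \<forall>k. X k \<omega> \<in> SPsi) \<and>
       (let \<Omega>star = {x \<in> SPsi. \<Psi> x = ereal \<Psi>star \<and> 0 \<in> limiting_subdiff \<Psi> x}
        in \<Omega>star \<noteq> {} \<and> compact \<Omega>star \<and> (\<forall>x\<in>\<Omega>star. KL_at \<Psi> x))
       \<longrightarrow>
       (AE \<omega> in M. summable (\<lambda>k. step_sum m lam k \<omega>)) \<and>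
       ((\<exists>CS>0. AE \<omega> in M. \<forall>\<^sub>F k in sequentially.
           norm (X (Suc k) \<omega> - X k \<omega>)
           \<le> CS * (step_sum m lam (Suc k) \<omega> + tail_sum \<sigma> k powr q))
        \<longrightarrow>
        (AE \<omega> in M. summable (\<lambda>k. norm (X (Suc k) \<omega> - X k \<omega>))) \<and>
        (\<exists>Xstar \<in> borel_measurable M.
           AE \<omega> in M. (\<lambda>k. X k \<omega>) \<longlonglongrightarrow> Xstar \<omega> \<and> Xstar \<omega> \<in> crit \<Psi>)))"
proof -
  interpret prob_space M by (rule prob)

  \<comment> \<open>Real-valued notation, measurability and signs\<close>
  define p where "p k \<omega> = real_of_ereal (\<Psi> (X k \<omega>))" for k \<omega>
  define S where "S k = tail_sum \<sigma> k powr q" for k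
  define D where "D k \<omega> = step_sum m lam k \<omega>" for k \<omega>
  have Psi_fin: "\<bar>\<Psi> x\<bar> \<noteq> \<infinity>" if "x \<in> edom \<Psi>" for x
    using Psi(1) that unfolding proper_fun_def edom_def by (cases "\<Psi> x") auto
  have Psi_p: "\<Psi> (X k \<omega>) = ereal (p k \<omega>)" if "\<omega> \<in> space M" for k \<omega>
    unfolding p_def using Psi_fin[OF X_dom[OF that]] by (simp add: ereal_real)
  have p_adapted: "p k \<in> borel_measurable (F k)" for k
    unfolding p_def
    by (intro borel_measurable_real_of_ereal measurable_compose[OF X_adapted]
        lower_semicont_borel_measurable Psi(2))
  have p_meas [measurable]: "p k \<in> borel_measurable M" for k
    by (rule measurable_from_subalg[OF filt(2) p_adapted])
  have sets_mono: "sets (F i) \<subseteq> sets (F j)" if "i \<le> j" for i j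
    using filt(1) that by (simp add: filtration_def)
  have S0: "0 \<le> S k" for k by (simp add: S_def)
  have S_sum: "summable S" using q(3) by (simp add: S_def[abs_def])
  have D0: "0 \<le> D k \<omega>" if "\<omega> \<in> space M" for k \<omega>
    unfolding D_def by (intro step_sum_nonneg lam_nonneg that)
  have tail0: "0 \<le> tail_sum \<sigma> k" for k by (rule tail_sum_nonneg[OF sigma])

  \<comment> \<open>Choice of the constants and the Lyapunov function\<close>
  obtain a1 a2 a3 :: "nat \<Rightarrow> real" where a: "\<And>l. l \<in> {1..m} \<Longrightarrow> 0 < a1 l \<and> a2 l + max (a3 l) 0 < a1 l"
    and desc: "\<And>k. k0 \<le> k \<Longrightarrow> AE \<omega> in M. real_cond_exp M (F k) (p (Suc k)) \<omega>
             \<le> p k \<omega> - (\<Sum>l=1..m. a1 l * real_cond_exp M (F k) (\<lambda>\<omega>. (lam l (Suc k) \<omega>)\<^sup>2) \<omega>)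
                + (\<Sum>l=1..m. a2 l * (lam l k \<omega>)\<^sup>2)
                + (\<Sum>l=1..m. a3 l * (lag (lam l) k \<omega>)\<^sup>2)
                + \<sigma> (Suc k)"
    using descent unfolding p_def[abs_def] by blast
  \<comment> \<open>\<open>\<eta> \<le> a1\<close> makes \<open>b1\<close> nonnegative. The slack
    \<open>a1 - a2 - max a3 0\<close> is divided by three because \<open>\<eta>\<close> is spent in
    \<open>b1\<close>, in \<open>b2\<close> and in the released decrease.\<close>
  obtain \<eta> where \<eta>: "0 < \<eta>" "\<And>l. l \<in> {1..m} \<Longrightarrow> \<eta> \<le> min (a1 l) ((a1 l - a2 l - max (a3 l) 0) / 3)"
    by (rule finite_positive_lower_bound[of "{1..m}" "\<lambda>l. min (a1 l) ((a1 l - a2 l - max (a3 l) 0) / 3)"])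
       (use a in force)+
  define b1 where "b1 l = a1 l - \<eta>" for l
  define b2 where "b2 l = max (a3 l) 0 + \<eta>" for l
  have b1: "0 \<le> b1 l" and b2: "0 \<le> b2 l" and b12: "a2 l + b2 l + \<eta> \<le> b1 l" if "l \<in> {1..m}" for l
    using \<eta>(2)[OF that] \<eta>(1) by (auto simp: b1_def b2_def field_simps)
  define N where "N = Suc (Suc k0)"
  define u where "u k \<omega> = (\<Sum>l=1..m. b1 l * (lam l k \<omega>)\<^sup>2 + b2 l * (lag (lam l) k \<omega>)\<^sup>2)" for k \<omega>
  define Q where "Q k \<omega> = (\<Sum>l=1..m. (lam l (Suc k) \<omega>)\<^sup>2 + (lam l k \<omega>)\<^sup>2 + (lag (lam l) k \<omega>)\<^sup>2)" for k \<omega>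
  define Y where "Y n \<omega> = p (n + N) \<omega> + u (n + N) \<omega> + tail_sum \<sigma> (n + N) - \<Psi>low" for n \<omega>
  define Z where "Z n \<omega> = \<eta> * Q (n + N) \<omega>" for n \<omega>
  interpret Y: nonneg_supermartingale M "\<lambda>n. F (n + N)" Y Z
    unfolding Y_def[abs_def] Z_def[abs_def] u_def[abs_def] Q_def[abs_def] N_def
  proof (rule lyapunov_supermartingale[where ?a1.0 = a1 and ?a2.0 = a2 and ?a3.0 = a3])
    show "AE \<omega> in M. \<Psi>low \<le> p k \<omega>" for k
      using X_low[of k] AE_space by eventually_elim (simp add: Psi_p)
    show "integrable M (p (Suc k))" if "k0 \<le> k" for k
      using integrable_Psi[OF that] by (simp add: p_def[abs_def])
  qed (use prob filt(2) sets_mono p_adapted lam_adapted sigma integrable_lam \<eta>(1) b1 b12 desc in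
      \<open>simp_all add: b1_def b2_def\<close>)

  have D_sq: "(D k \<omega>)\<^sup>2 \<le> 3 * real m * Q k \<omega>" for k \<omega>
    unfolding D_def Q_def by (rule step_sum_square_le)
  define B where "B = (\<Sum>l=1..m. b1 l + b2 l)"
  have B0: "0 \<le> B" unfolding B_def using b1 b2 by (intro sum_nonneg add_nonneg_nonneg)
  \<comment> \<open>This bound makes \<open>u\<close> vanish together with \<open>D\<close> and
    later controls the quadratic part of the gap in \<open>KL_gap_split\<close>.\<close>
  have u_le: "u k \<omega> \<le> B * (D k \<omega>)\<^sup>2" and u0: "0 \<le> u k \<omega>" if \<omega>: "\<omega> \<in> space M" for k \<omega>
  proof -
    have "u k \<omega> \<le> (\<Sum>l=1..m. b1 l * (D k \<omega>)\<^sup>2 + b2 l * (D k \<omega>)\<^sup>2)"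
      unfolding u_def D_def using b1 b2 lam_nonneg[OF _ \<omega>]
      by (intro sum_mono add_mono mult_left_mono power_mono le_step_sum lag_nonneg) auto
    also have "\<dots> = B * (D k \<omega>)\<^sup>2"
      by (simp add: B_def sum_distrib_right distrib_right)
    finally show "u k \<omega> \<le> B * (D k \<omega>)\<^sup>2" .
    show "0 \<le> u k \<omega>" unfolding u_def using b1 b2 by (intro sum_nonneg add_nonneg_nonneg mult_nonneg_nonneg) auto
  qed

  \<comment> \<open>Vanishing of the steps\<close>
  have D_lim: "AE \<omega> in M. (\<lambda>k. D k \<omega>) \<longlonglongrightarrow> 0"
    using Y.AE_summable_Z AE_space
  proof eventually_elim
    case (elim \<omega>)
    then have "(\<lambda>n. Z n \<omega>) \<longlonglongrightarrow> 0" by (intro summable_LIMSEQ_zero)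
    then have "(\<lambda>n. 3 * real m * (Z n \<omega> / \<eta>)) \<longlonglongrightarrow> 3 * real m * (0 / \<eta>)"
      using \<eta>(1) by (intro tendsto_intros) auto
    then have "(\<lambda>n. 3 * real m * Q (n + N) \<omega>) \<longlonglongrightarrow> 0"
      using \<eta>(1) by (simp add: Z_def)
    then have "(\<lambda>n. (D (n + N) \<omega>)\<^sup>2) \<longlonglongrightarrow> 0"
      by (rule Lim_null_comparison[rotated]) (simp add: D_sq)
    then have "(\<lambda>n. sqrt ((D (n + N) \<omega>)\<^sup>2)) \<longlonglongrightarrow> sqrt 0" by (rule tendsto_real_sqrt)
    then have "(\<lambda>n. D (n + N) \<omega>) \<longlonglongrightarrow> 0" using D0[OF elim(2)] by simp
    then show ?case by (rule LIMSEQ_offset)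
  qed
  have lam_lim: "AE \<omega> in M. (\<lambda>k. lam l k \<omega>) \<longlonglongrightarrow> 0" if l: "l \<in> {1..m}" for l
    using D_lim AE_space
  proof eventually_elim
    case (elim \<omega>)
    show ?case
      using elim(1)
      by (rule Lim_null_comparison[rotated])
         (use lam_nonneg[OF _ elim(2)] l in \<open>auto simp: D_def intro!: always_eventually le_step_sum\<close>)
  qed
  have u_lim: "AE \<omega> in M. (\<lambda>k. u k \<omega>) \<longlonglongrightarrow> 0"
    using D_lim AE_space
  proof eventually_elim
    case (elim \<omega>)
    have "(\<lambda>k. B * (D k \<omega>)\<^sup>2) \<longlonglongrightarrow> B * 0\<^sup>2" by (intro tendsto_intros elim)
    then have "(\<lambda>k. B * (D k \<omega>)\<^sup>2) \<longlonglongrightarrow> 0" by simp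
    then show ?case
      by (rule Lim_null_comparison[rotated]) (use u_le u0 elim(2) in simp)
  qed
  have tail_lim: "tail_sum \<sigma> \<longlonglongrightarrow> 0" by (rule tail_sum_tendsto_0[OF sigma(2)])
  have S_lim: "S \<longlonglongrightarrow> 0" by (rule summable_LIMSEQ_zero[OF S_sum])

  \<comment> \<open>Convergence of the function values\<close>
  define \<Psi>inf where "\<Psi>inf \<omega> = lim (\<lambda>k. p k \<omega>)" for \<omega>
  \<comment> \<open>A pointwise \<open>lim\<close> of measurable functions is measurable, whatever
    value it takes on the null set of divergence.\<close>
  have inf_meas: "\<Psi>inf \<in> borel_measurable M"
    unfolding \<Psi>inf_def[abs_def] by measurable
  have p_lim: "AE \<omega> in M. (\<lambda>k. p k \<omega>) \<longlonglongrightarrow> \<Psi>inf \<omega>"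
    using Y.AE_convergent u_lim
  proof eventually_elim
    case (elim \<omega>)
    obtain y where y: "(\<lambda>n. Y n \<omega>) \<longlonglongrightarrow> y" using elim(1) by (auto simp: convergent_def)
    have "(\<lambda>n. Y n \<omega> - u (n + N) \<omega> - tail_sum \<sigma> (n + N) + \<Psi>low) \<longlonglongrightarrow> y - 0 - 0 + \<Psi>low"
      by (intro tendsto_add tendsto_diff y LIMSEQ_ignore_initial_segment[OF elim(2)]
          LIMSEQ_ignore_initial_segment[OF tail_lim] tendsto_const)
    then have "(\<lambda>n. p (n + N) \<omega>) \<longlonglongrightarrow> y + \<Psi>low" by (simp add: Y_def)
    then have "(\<lambda>k. p k \<omega>) \<longlonglongrightarrow> y + \<Psi>low" by (rule LIMSEQ_offset)
    then show ?case unfolding \<Psi>inf_def by (simp add: limI)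
  qed
  have Psi_lim: "AE \<omega> in M. (\<lambda>k. \<Psi> (X k \<omega>)) \<longlonglongrightarrow> ereal (\<Psi>inf \<omega>)"
    using p_lim AE_space by eventually_elim (simp add: Psi_p)

  \<comment> \<open>Stationarity of the cluster points\<close>
  obtain Cre where Cre: "0 < Cre" and rel: "AE \<omega> in M. \<forall>\<^sub>F k in sequentially.
          dist_zero (limiting_subdiff \<Psi> (X k \<omega>)) \<le> ereal (Cre * (D k \<omega> + S k))"
    using relative_error unfolding D_def S_def by blast
  \<comment> \<open>The value at the cluster point is recorded as well; under the KL assumptions it
    places the point in the set where the KL property holds.\<close>
  have cluster: "AE \<omega> in M. \<forall>x r. strict_mono r \<and> (\<lambda>n. X (r n) \<omega>) \<longlonglongrightarrow> x \<longrightarrow>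
      x \<in> crit \<Psi> \<and> \<Psi> x = ereal (\<Psi>inf \<omega>)"
    using rel Psi_lim D_lim AE_space
  proof eventually_elim
    case (elim \<omega>)
    show ?case
    proof (intro allI impI)
      fix x r assume "strict_mono r \<and> (\<lambda>n. X (r n) \<omega>) \<longlonglongrightarrow> x"
      then have r: "strict_mono r" and x: "(\<lambda>n. X (r n) \<omega>) \<longlonglongrightarrow> x" by auto
      have lim: "(\<lambda>n. \<Psi> (X (r n) \<omega>)) \<longlonglongrightarrow> ereal (\<Psi>inf \<omega>)"
        using LIMSEQ_subseq_LIMSEQ[OF elim(2) r] by (simp add: o_def)
      \<comment> \<open>Lower semicontinuity first puts the limit into the domain; only then does
        continuity relative to the domain apply.\<close>
      have "\<Psi> x \<le> ereal (\<Psi>inf \<omega>)"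
        by (rule lower_semicont_le_limit[OF Psi(2) x lim])
      then have x_dom: "x \<in> edom \<Psi>" by (auto simp: edom_def)
      have lim': "(\<lambda>n. \<Psi> (X (r n) \<omega>)) \<longlonglongrightarrow> \<Psi> x"
        using continuity X_dom[OF elim(4)] x_dom x
        unfolding continuous_on_sequentially by (auto simp: o_def)
      have "x \<in> crit \<Psi>"
      proof (rule crit_limit[OF x lim' Psi_fin[OF x_dom]])
        show "\<forall>\<^sub>F n in sequentially. dist_zero (limiting_subdiff \<Psi> (X (r n) \<omega>))
            \<le> ereal (Cre * (D (r n) \<omega> + S (r n)))"
          using eventually_subseq[OF r elim(1)] .
        have "(\<lambda>k. Cre * (D k \<omega> + S k)) \<longlonglongrightarrow> Cre * (0 + 0)"
          by (intro tendsto_intros elim S_lim)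
        from LIMSEQ_subseq_LIMSEQ[OF this r]
        show "(\<lambda>n. Cre * (D (r n) \<omega> + S (r n))) \<longlonglongrightarrow> 0" by (simp add: o_def)
      qed
      moreover have "\<Psi> x = ereal (\<Psi>inf \<omega>)"
        using lim lim' by (rule LIMSEQ_unique[symmetric])
      ultimately show "x \<in> crit \<Psi> \<and> \<Psi> x = ereal (\<Psi>inf \<omega>)" by simp
    qed
  qed

  \<comment> \<open>Summability of the steps under the KL property\<close>
  have finite_length: "AE \<omega> in M. summable (\<lambda>k. D k \<omega>)"
    if star: "AE \<omega> in M. \<Psi>inf \<omega> = \<Psi>star" and K: "compact K" "AE \<omega> in M. \<forall>k. X k \<omega> \<in> K"
      and crit_K: "compact {x \<in> K. \<Psi> x = ereal \<Psi>star \<and> 0 \<in> limiting_subdiff \<Psi> x}"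
      and KL: "\<And>x. x \<in> K \<Longrightarrow> \<Psi> x = ereal \<Psi>star \<Longrightarrow> 0 \<in> limiting_subdiff \<Psi> x \<Longrightarrow> KL_at \<Psi> x"
    for \<Psi>star :: real and K :: "(real ^ 'd) set"
  proof -
    define e where "e n \<omega> = Y n \<omega> - (\<Psi>star - \<Psi>low)" for n \<omega>
    \<comment> \<open>The three summands are the parts \<open>a\<close>, \<open>u\<close>,
      \<open>v\<close> of \<open>KL_gap_split\<close>. The function gap alone may be negative; only
      the full gap \<open>e\<close> is known to be nonnegative.\<close>
    have e_eq: "e n \<omega> = (p (n + N) \<omega> - \<Psi>star) + u (n + N) \<omega> + tail_sum \<sigma> (n + N)" for n \<omega>
      by (simp add: e_def Y_def)
    have Y_lim: "AE \<omega> in M. (\<lambda>n. Y n \<omega>) \<longlonglongrightarrow> \<Psi>star - \<Psi>low"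
      using star p_lim u_lim
    proof eventually_elim
      case (elim \<omega>)
      have "(\<lambda>k. p k \<omega> + u k \<omega> + tail_sum \<sigma> k - \<Psi>low) \<longlonglongrightarrow> \<Psi>star + 0 + 0 - \<Psi>low"
        using elim(1,2) by (intro tendsto_add tendsto_diff elim(3) tail_lim tendsto_const) simp
      from LIMSEQ_ignore_initial_segment[OF this, of N] show ?case by (simp add: Y_def)
    qed
    interpret e: nonneg_supermartingale M "\<lambda>n. F (n + N)" e Z
      unfolding e_def[abs_def] by (rule Y.shift_by_limit[OF Y_lim])
    obtain W U \<epsilon> where W: "finite W" "\<And>w. w \<in> W \<Longrightarrow> KL_weight w" and U: "open U"
        "{x \<in> K. \<Psi> x = ereal \<Psi>star \<and> 0 \<in> limiting_subdiff \<Psi> x} \<subseteq> U" and \<epsilon>: "0 < \<epsilon>"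
      and KLU: "\<And>x s t. x \<in> U \<Longrightarrow> \<Psi> x = ereal (\<Psi>star + s) \<Longrightarrow> 0 < s \<Longrightarrow> s \<le> t \<Longrightarrow> t \<le> 3 * s \<Longrightarrow> t < \<epsilon> \<Longrightarrow>
       \<exists>w\<in>W. 1 \<le> ereal (w t) * dist_zero (limiting_subdiff \<Psi> x)"
      by (rule KL_uniformize[OF crit_K, of \<Psi> \<Psi>star]) (use KL in auto)
    define W' where "W' = W \<union> {\<lambda>t. if t \<in> {0<..<1} then t powr (- (1/2)) else 0,
                    \<lambda>t. if t \<in> {0<..<1} then t powr (- q) else 0}"
    have W': "finite W'" "\<And>w. w \<in> W' \<Longrightarrow> KL_weight w"
      using W KL_weight_powr[of "1/2"] KL_weight_powr[OF q(1,2)] by (auto simp: W'_def)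
    have W'0: "0 \<le> w t" if "w \<in> W'" "0 \<le> t" for w t
      using W'(2)[OF that(1)] that(2) by (simp add: KL_weight_def)
    define C where "C = Cre + sqrt (3 * B) + 3"
    have C0: "0 \<le> C" using Cre B0 by (simp add: C_def)
    \<comment> \<open>Finitely many weights share one exceptional null set.\<close>
    have weighted: "AE \<omega> in M. \<forall>w\<in>W'. summable (\<lambda>n. w (e n \<omega>) * Z n \<omega>)"
      using W' by (intro AE_finite_allI e.AE_summable_KL_weight)
    have absorb: "AE \<omega> in M. \<forall>n. e n \<omega> = 0 \<longrightarrow> e (Suc n) \<omega> = 0 \<and> Z n \<omega> = 0"
      unfolding AE_all_countable using e.AE_zero_absorbing by blast
    have e_nonneg: "AE \<omega> in M. \<forall>n. 0 \<le> e n \<omega>"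
      unfolding AE_all_countable using e.Y_nonneg by blast
    show ?thesis
      using weighted absorb e_nonneg Y_lim rel cluster K(2) star AE_space
    proof eventually_elim
      case (elim \<omega>)
      \<comment> \<open>Cluster points are critical with value \<open>\<Psi>star\<close>, hence lie
        in the set covered by \<open>U\<close>.\<close>
      have "\<forall>\<^sub>F k in sequentially. X k \<omega> \<in> U"
      proof (rule eventually_in_open_of_cluster_points[OF K(1) _ U(1)])
        fix r a assume "strict_mono r" "(\<lambda>n. X (r n) \<omega>) \<longlonglongrightarrow> a" "a \<in> K"
        then have "a \<in> crit \<Psi>" "\<Psi> a = ereal \<Psi>star" "a \<in> K"
          using elim(6,8) by auto
        then show "a \<in> U" using U(2) by (auto simp: crit_def)
      qed (use elim(7) in auto)
      then have inU: "\<forall>\<^sub>F n in sequentially. X (n + N) \<omega> \<in> U" by (rule sequentially_offset)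
      have e_lim: "(\<lambda>n. e n \<omega>) \<longlonglongrightarrow> 0"
        using tendsto_diff[OF elim(4) tendsto_const[of "\<Psi>star - \<Psi>low"]] by (simp add: e_def)
      have small: "\<forall>\<^sub>F n in sequentially. e n \<omega> < min \<epsilon> 1"
        using e_lim \<epsilon> by (intro order_tendstoD(2)) auto
      \<comment> \<open>The summable majorant. It adds up all weights because the one that works may
        change with \<open>n\<close>; the factor \<open>3 * m / \<eta>\<close> converts
        \<open>Z\<close> into a bound on the square of \<open>D\<close>.\<close>
      define g where "g n = S (n + N) + 2 * C * (3 * real m / \<eta> * (\<Sum>w\<in>W'. w (e n \<omega>) * Z n \<omega>))" for n
      have "summable g"
        unfolding g_def using elim(1) S_sum
        by (intro summable_add summable_mult summable_sum) (auto simp: summable_iff_shift)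
      moreover have "\<forall>\<^sub>F n in sequentially. norm (D (n + N) \<omega>) \<le> g n"
        using inU small sequentially_offset[OF elim(5), of N]
      proof eventually_elim
        case (elim n)
        note \<omega> = \<open>\<omega> \<in> space M\<close>
        have Z0: "0 \<le> Z n \<omega>" using \<omega> by (rule Y.Z_nonneg)
        have en: "0 \<le> e n \<omega>" using \<open>\<forall>n. 0 \<le> e n \<omega>\<close> by blast
        have D_Z: "(D (n + N) \<omega>)\<^sup>2 \<le> 3 * real m / \<eta> * Z n \<omega>"
          using D_sq[of "n + N" \<omega>] \<eta>(1) by (simp add: Z_def)
        have sum0: "0 \<le> (\<Sum>w\<in>W'. w (e n \<omega>) * Z n \<omega>)"
          using W'0 en Z0 by (intro sum_nonneg mult_nonneg_nonneg) auto
        have "D (n + N) \<omega> \<le> g n"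
        proof (cases "e n \<omega> = 0")
          case True
          \<comment> \<open>At gap 0 the weights give no information, but absorption forces the
            decrease, and with it \<open>D\<close>, to vanish.\<close>
          then have "Z n \<omega> = 0" using \<open>\<forall>n. e n \<omega> = 0 \<longrightarrow> e (Suc n) \<omega> = 0 \<and> Z n \<omega> = 0\<close> by blast
          then have "D (n + N) \<omega> = 0" using D_Z by simp
          then show ?thesis
            unfolding g_def using S0 C0 \<eta>(1) sum0
            by (simp only:) (intro add_nonneg_nonneg mult_nonneg_nonneg divide_nonneg_nonneg; simp)
        next
          case False
          have "\<exists>w\<in>W'. 1 \<le> w (e n \<omega>) * (Cre + sqrt (3 * B) + 3) * (D (n + N) \<omega> + tail_sum \<sigma> (n + N) powr q)"
            unfolding W'_def
          proof (rule KL_gap_split[OF _ _ e_eq q(1,2) D0[OF \<omega>] tail0 u_le[OF \<omega>] B0 less_imp_le[OF Cre] _ _ u0[OF \<omega>]])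
            show "dist_zero (limiting_subdiff \<Psi> (X (n + N) \<omega>)) \<le> ereal (Cre * (D (n + N) \<omega> + tail_sum \<sigma> (n + N) powr q))"
              using elim(3) by (simp add: S_def)
            show "\<exists>w\<in>W. 1 \<le> ereal (w (e n \<omega>)) * dist_zero (limiting_subdiff \<Psi> (X (n + N) \<omega>))"
              if "0 < p (n + N) \<omega> - \<Psi>star" "p (n + N) \<omega> - \<Psi>star \<le> e n \<omega>" "e n \<omega> \<le> 3 * (p (n + N) \<omega> - \<Psi>star)"
              using that elim(1,2) by (intro KLU[of _ "p (n + N) \<omega> - \<Psi>star"]) (auto simp: Psi_p[OF \<omega>])
            show "0 \<le> w (e n \<omega>)" if "w \<in> W" for w
              using W'0[OF _ en, of w] that unfolding W'_def by blast
            show "0 < e n \<omega>" "e n \<omega> < 1" using False en elim(2) by simp_all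
          qed
          then obtain w where w: "w \<in> W'" "1 \<le> w (e n \<omega>) * C * (D (n + N) \<omega> + S (n + N))"
            by (auto simp: C_def S_def)
          have w0: "0 \<le> w (e n \<omega>)" using W'0[OF w(1) en] .
          have "D (n + N) \<omega> \<le> S (n + N) + 2 * C * (w (e n \<omega>) * (D (n + N) \<omega>)\<^sup>2)"
            by (rule weighted_square_bound[OF w(2) D0[OF \<omega>] S0 w0 C0])
          also have "w (e n \<omega>) * (D (n + N) \<omega>)\<^sup>2 \<le> w (e n \<omega>) * (3 * real m / \<eta> * Z n \<omega>)"
            by (intro mult_left_mono D_Z w0)
          also have "\<dots> = 3 * real m / \<eta> * (w (e n \<omega>) * Z n \<omega>)" by simp
          also have "\<dots> \<le> 3 * real m / \<eta> * (\<Sum>w\<in>W'. w (e n \<omega>) * Z n \<omega>)"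
            using W'(1) w(1) W'0 en Z0 \<eta>(1)
            by (intro mult_left_mono member_le_sum mult_nonneg_nonneg) auto
          finally show ?thesis
            using C0 by (simp add: g_def mult_left_mono)
        qed
        then show ?case using D0[OF \<omega>] by simp
      qed
      ultimately have "summable (\<lambda>n. D (n + N) \<omega>)"
        by (rule summable_comparison_test_ev[rotated])
      then show ?case using summable_iff_shift[of "\<lambda>k. D k \<omega>" N] by blast
    qed
  qed

  \<comment> \<open>Finite length and convergence of the iterates\<close>
  have conv: "(AE \<omega> in M. summable (\<lambda>k. norm (X (Suc k) \<omega> - X k \<omega>))) \<and>
      (\<exists>Xstar \<in> borel_measurable M. AE \<omega> in M. (\<lambda>k. X k \<omega>) \<longlonglongrightarrow> Xstar \<omega> \<and> Xstar \<omega> \<in> crit \<Psi>)"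
    if sum: "AE \<omega> in M. summable (\<lambda>k. D k \<omega>)"
      and step: "AE \<omega> in M. \<forall>\<^sub>F k in sequentially. norm (X (Suc k) \<omega> - X k \<omega>) \<le> CS * (D (Suc k) \<omega> + S k)"
    for CS
  proof -
    have norm_sum: "AE \<omega> in M. summable (\<lambda>k. norm (X (Suc k) \<omega> - X k \<omega>))"
      using sum step
    proof eventually_elim
      case (elim \<omega>)
      have "summable (\<lambda>k. CS * (D (Suc k) \<omega> + S k))"
        using elim(1) S_sum summable_Suc_iff[of "\<lambda>k. D k \<omega>"]
        by (intro summable_mult summable_add) auto
      then show ?case
        by (rule summable_comparison_test_ev[rotated]) (use elim(2) in simp)
    qed
    have [measurable]: "X k \<in> borel_measurable M" for k
      by (rule measurable_from_subalg[OF filt(2) X_adapted])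
    have meas: "(\<lambda>\<omega>. lim (\<lambda>k. X k \<omega>)) \<in> borel_measurable M" by measurable
    have "AE \<omega> in M. (\<lambda>k. X k \<omega>) \<longlonglongrightarrow> lim (\<lambda>k. X k \<omega>) \<and> lim (\<lambda>k. X k \<omega>) \<in> crit \<Psi>"
      using norm_sum cluster
    proof eventually_elim
      case (elim \<omega>)
      have "summable (\<lambda>k. X (Suc k) \<omega> - X k \<omega>)" using elim(1) by (rule summable_norm_cancel)
      then have "convergent (\<lambda>n. \<Sum>k<n. X (Suc k) \<omega> - X k \<omega>)"
        by (simp add: summable_iff_convergent)
      then have "convergent (\<lambda>n. X n \<omega> - X 0 \<omega>)"
        by (simp add: sum_lessThan_telescope[of "\<lambda>k. X k \<omega>"])
      then have "convergent (\<lambda>n. X n \<omega> - X 0 \<omega> + X 0 \<omega>)" by (intro convergent_add convergent_const)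
      then have lim: "(\<lambda>k. X k \<omega>) \<longlonglongrightarrow> lim (\<lambda>k. X k \<omega>)" by (simp add: convergent_LIMSEQ_iff)
      \<comment> \<open>The limit is the cluster point along the identity subsequence.\<close>
      moreover have "lim (\<lambda>k. X k \<omega>) \<in> crit \<Psi>"
        using elim(2)[rule_format, of "\<lambda>n. n"] lim by (simp add: strict_mono_def)
      ultimately show ?case ..
    qed
    then show ?thesis
      by (intro conjI norm_sum bexI[OF _ meas])
  qed

  show ?thesis
  proof (intro exI[of _ \<Psi>inf] conjI allI impI ballI)
    show "AE \<omega> in M. \<forall>x r. strict_mono r \<and> (\<lambda>n. X (r n) \<omega>) \<longlonglongrightarrow> x \<longrightarrow> x \<in> crit \<Psi>"
      using cluster by eventually_elim blast
  next
    fix \<Psi>star :: real and SPsi :: "(real ^ 'd) set"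
    assume "(AE \<omega> in M. \<Psi>inf \<omega> = \<Psi>star) \<and>
       compact SPsi \<and> (AE \<omega> in M. \<forall>k. X k \<omega> \<in> SPsi) \<and>
       (let \<Omega>star = {x \<in> SPsi. \<Psi> x = ereal \<Psi>star \<and> 0 \<in> limiting_subdiff \<Psi> x}
        in \<Omega>star \<noteq> {} \<and> compact \<Omega>star \<and> (\<forall>x\<in>\<Omega>star. KL_at \<Psi> x))"
    then have sum: "AE \<omega> in M. summable (\<lambda>k. D k \<omega>)"
      by (intro finite_length[of \<Psi>star SPsi]) (auto simp: Let_def)
    then show "AE \<omega> in M. summable (\<lambda>k. step_sum m lam k \<omega>)"
      by (simp add: D_def)
    assume "\<exists>CS>0. AE \<omega> in M. \<forall>\<^sub>F k in sequentially.
           norm (X (Suc k) \<omega> - X k \<omega>)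
           \<le> CS * (step_sum m lam (Suc k) \<omega> + tail_sum \<sigma> k powr q)"
    then obtain CS where "AE \<omega> in M. \<forall>\<^sub>F k in sequentially.
        norm (X (Suc k) \<omega> - X k \<omega>) \<le> CS * (D (Suc k) \<omega> + S k)"
      unfolding D_def S_def by blast
    note conv[OF sum this]
    then show "AE \<omega> in M. summable (\<lambda>k. norm (X (Suc k) \<omega> - X k \<omega>))"
      and "\<exists>Xstar \<in> borel_measurable M. AE \<omega> in M. (\<lambda>k. X k \<omega>) \<longlonglongrightarrow> Xstar \<omega> \<and> Xstar \<omega> \<in> crit \<Psi>"
      by blast+
  qed (use inf_meas Psi_lim tail_lim lam_lim in auto)
qed

end
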